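(* Consider the empire process with merger rate function $\lambda$. (i) Suppose (for some $c>0$) we have $$\lambda(A,B)\ \ge\ c\,L(A,B)\qquad\text{for all } A,B .$$ Then the empire process is hegemonic. (ii) Suppose (for some $C<\infty$) we have $$\sum_j \lambda(A,B_j)\,\mathrm{peri}(B_j)\ \le\ C\,\mathrm{peri}(A)\qquad\text{for all } A \text{ with adjacent regions } (B_j).$$ Then the empire process is not hegemonic.
   Context: Empire process. The empire process with merger rate function $\lambda$ is a random process such that at each time $t$ the plane is partitioned into polygonal regions and, as $t$ increases, adjacent regions $A,B$ merge into one region $A\cup B$ stochastically at rate (probability per unit time) $\lambda(A,B)$. Here $\lambda(A,B)$ is a specified function of the geometry of the regions $A$ and $B$. For a region $A$, $\mathrm{peri}(A)$ is its perimeter (boundary length), and $L(A,B)$ is the length of the boundary between $A$ and $B$; $A$ and $B$ are adjacent if $L(A,B)>0$. It is assumed that $\lambda(A,B)>0$ if $L(A,B)>0$, and $\lambda(A,B)=0$ if $L(A,B)=0$. The initial configuration is a partition of the plane into polygonal regions, naturally assumed to be statistically translation-invariant (for example the square grid, the hexagonal lattice, or the Voronoi tessellation on random points). Hegemonic. The empire process is called hegemonic if infinite-area regions appear in finite time. It is presumed that the choice of initial configuration does not affect whether this property holds, and that the property has probability zero or one; "not hegemonic" means that the property does not hold. *)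

theory Defs
  imports "HOL-Analysis.Analysis" "HOL-Probability.Probability"
begin

type_synonym plane = "real ^ 2"
type_synonym region = "plane set"
type_synonym config = "region set"

section \<open>Geometry of regions\<close>

text \<open>
  One-dimensional Hausdorff measure: the limit, as the mesh \<open>d\<close> tends to 0, of the infimum of the
  total diameter over countable covers by sets of diameter at most \<open>d\<close>. The explicit boundedness
  is needed because \<^const>\<open>diameter\<close> is unspecified on unbounded sets.
\<close>
definition curve_length :: "plane set \<Rightarrow> ennreal" where
  "curve_length S =
     (SUP d\<in>{0::real<..}.
        INF U\<in>{U :: nat \<Rightarrow> plane set. S \<subseteq> (\<Union>i. U i) \<and> (\<forall>i. bounded (U i) \<and> diameter (U i) \<le> d)}.
          (\<Sum>i. ennreal (diameter (U i))))"

definition peri :: "region \<Rightarrow> ennreal" where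
  "peri A = curve_length (frontier A)"

definition common_length :: "region \<Rightarrow> region \<Rightarrow> ennreal" where
  "common_length A B = curve_length (frontier A \<inter> frontier B)"

definition area :: "region \<Rightarrow> ennreal" where
  "area A = emeasure lborel A"

text \<open>
  Regions are closed, connected and bounded; they need not be convex or simply connected, since
  merging produces non-convex regions and regions with holes. Different regions of a partition
  overlap only along their boundaries.
\<close>
definition polygonal :: "region \<Rightarrow> bool" where
  "polygonal A \<longleftrightarrow> connected A \<and>
     (\<exists>F. finite F \<and> F \<noteq> {} \<and> (\<forall>K\<in>F. polytope K \<and> interior K \<noteq> {}) \<and> A = \<Union>F)"

definition non_overlapping :: "region \<Rightarrow> region \<Rightarrow> bool" where
  "non_overlapping A B \<longleftrightarrow> interior A \<inter> interior B = {}"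

definition tessellation :: "config \<Rightarrow> bool" where
  "tessellation P \<longleftrightarrow>
     (\<forall>A\<in>P. polygonal A) \<and> \<Union>P = UNIV \<and> pairwise non_overlapping P \<and>
     (\<forall>r. finite {A\<in>P. A \<inter> cball 0 r \<noteq> {}})"

definition neighbours :: "config \<Rightarrow> region \<Rightarrow> region set" where
  "neighbours P A = {B\<in>P. B \<noteq> A \<and> common_length A B > 0}"

section \<open>Merger rates\<close>

definition merger_rate :: "(region \<Rightarrow> region \<Rightarrow> real) \<Rightarrow> bool" where
  "merger_rate rate \<longleftrightarrow>
     (\<forall>A B. polygonal A \<and> polygonal B \<and> non_overlapping A B \<longrightarrow>
        rate A B = rate B A \<and>
        (common_length A B > 0 \<longrightarrow> rate A B > 0) \<and>
        (common_length A B = 0 \<longrightarrow> rate A B = 0))"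

section \<open>The empire process\<close>

definition merge :: "config \<Rightarrow> region \<Rightarrow> region \<Rightarrow> config" where
  "merge Q A B = insert (A \<union> B) (Q - {A, B})"

definition may_merge :: "config \<Rightarrow> config \<Rightarrow> region \<Rightarrow> region \<Rightarrow> bool" where
  "may_merge W Q A B \<longleftrightarrow>
     A \<in> Q \<and> B \<in> neighbours Q A \<and> A \<subseteq> \<Union>W \<and> B \<subseteq> \<Union>W"

text \<open>
  The process in a finite window: the cells of the initial tessellation \<open>P\<close> that belong to the
  finite set \<open>W\<close> take part in mergers, all other cells stay as they are. It is the finite-state
  continuous-time Markov chain in which adjacent regions merge at rate \<open>rate A B\<close>, given by
  its infinitesimal description: conditionally on the history \<open>H\<close> up to time \<open>t\<close>, the given
  merger happens during \<open>[t, t + h]\<close> with probability \<open>rate A B * h + o(h)\<close>, and anything other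
  than one merger or no change has probability \<open>o(h)\<close>, uniformly in \<open>t\<close> and in the history.
\<close>
definition window_process ::
  "(region \<Rightarrow> region \<Rightarrow> real) \<Rightarrow> config \<Rightarrow> config \<Rightarrow> 'w measure \<Rightarrow> (real \<Rightarrow> 'w \<Rightarrow> config) \<Rightarrow> bool"
where
  "window_process rate P W M Z \<longleftrightarrow>
     (\<forall>t\<ge>0. \<forall>Q. {\<omega>\<in>space M. Z t \<omega> = Q} \<in> sets M) \<and>
     (\<forall>\<omega>\<in>space M. Z 0 \<omega> = P) \<and>
     (\<forall>\<omega>\<in>space M. \<forall>t\<ge>0. \<exists>d>0. \<forall>u\<in>{t..<t + d}. Z u \<omega> = Z t \<omega>) \<and>
     (\<forall>e>0. \<exists>d>0. \<forall>t\<ge>0. \<forall>h. 0 < h \<and> h < d \<longrightarrow>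
       (\<forall>S z. finite S \<and> S \<subseteq> {0..t} \<and> t \<in> S \<longrightarrow>
         (let H = {\<omega>\<in>space M. \<forall>s\<in>S. Z s \<omega> = z s}; Q = z t in
           (\<forall>A B. may_merge W Q A B \<longrightarrow>
              \<bar>measure M {\<omega>\<in>H. Z (t + h) \<omega> = merge Q A B} - rate A B * h * measure M H\<bar>
                \<le> e * h * measure M H) \<and>
           measure M {\<omega>\<in>H. Z (t + h) \<omega> \<notin> insert Q {merge Q A B |A B. may_merge W Q A B}}
             \<le> e * h * measure M H)))"

definition in_same_region :: "config \<Rightarrow> region \<Rightarrow> region \<Rightarrow> bool" where
  "in_same_region Q A B \<longleftrightarrow> (\<exists>R\<in>Q. A \<subseteq> R \<and> B \<subseteq> R)"

text \<open>
  The process \<open>X\<close> on the whole plane started from the tessellation \<open>P\<close> is a limit of the processes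
  in windows exhausting the plane: at each time, two initial cells are in the same region of \<open>X\<close>
  iff they are in the same region for all large windows. (Infinitely many mergers happen in any
  time interval, and the rates between bounded regions do not by themselves determine a process
  on the whole plane: they do not exclude an unbounded region entering spontaneously ``from
  infinity''.) The regions of \<open>X\<close> are unions of possibly infinitely many initial cells.
\<close>
definition empire_process ::
  "(region \<Rightarrow> region \<Rightarrow> real) \<Rightarrow> config \<Rightarrow> 'w measure \<Rightarrow> (real \<Rightarrow> 'w \<Rightarrow> config) \<Rightarrow> bool"
where
  "empire_process rate P M X \<longleftrightarrow>
     prob_space M \<and>
     (\<forall>\<omega>\<in>space M. X 0 \<omega> = P) \<and>
     (\<forall>\<omega>\<in>space M. \<forall>t\<ge>0. \<exists>C. partition_on P C \<and> X t \<omega> = Union ` C) \<and>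
     (\<forall>\<omega>\<in>space M. \<forall>s\<ge>0. \<forall>t\<ge>s. \<forall>R\<in>X s \<omega>. \<exists>R'\<in>X t \<omega>. R \<subseteq> R') \<and>
     (\<exists>(r :: nat \<Rightarrow> real) Z.
        filterlim r at_top sequentially \<and>
        (\<forall>n. window_process rate P {A\<in>P. A \<subseteq> cball 0 (r n)} M (Z n)) \<and>
        (\<forall>t\<ge>0. AE \<omega> in M. \<forall>A\<in>P. \<forall>B\<in>P. \<forall>\<^sub>F n in sequentially.
           in_same_region (Z n t \<omega>) A B = in_same_region (X t \<omega>) A B))"

section \<open>Initial configurations\<close>

definition translate :: "plane \<Rightarrow> config \<Rightarrow> config" where
  "translate v P = (\<lambda>A. (+) v ` A) ` P"

text \<open>
  The law of a statistically translation-invariant random tessellation. The \<open>\<sigma>\<close>-algebra has to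
  contain the events that two given points share a region.
\<close>
definition initial_law :: "config measure \<Rightarrow> bool" where
  "initial_law \<mu> \<longleftrightarrow>
     prob_space \<mu> \<and>
     (AE P in \<mu>. tessellation P) \<and>
     (\<forall>x y. {P\<in>space \<mu>. \<exists>A\<in>P. x \<in> A \<and> y \<in> A} \<in> sets \<mu>) \<and>
     (\<forall>v. translate v \<in> measurable \<mu> \<mu> \<and> distr \<mu> \<mu> (translate v) = \<mu>)"

definition square_grid :: config where
  "square_grid =
     range (\<lambda>k :: int ^ 2. cbox (\<chi> i. real_of_int (k $ i)) (\<chi> i. real_of_int (k $ i) + 1))"

text \<open>
  By translation invariance the shift of the grid is uniformly distributed modulo the grid.
\<close>
definition square_grid_law :: "config measure \<Rightarrow> bool" where
  "square_grid_law \<mu> \<longleftrightarrow> initial_law \<mu> \<and> (AE P in \<mu>. \<exists>v. P = translate v square_grid)"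

section \<open>Hegemony\<close>

definition infinite_region_appears :: "(real \<Rightarrow> 'w \<Rightarrow> config) \<Rightarrow> 'w \<Rightarrow> bool" where
  "infinite_region_appears X \<omega> \<longleftrightarrow> (\<exists>t\<ge>0. \<exists>R\<in>X t \<omega>. area R = \<infinity>)"

text \<open>
  Hegemony is regarded as a property of probability zero or one: \<open>hegemonic\<close> says that it has
  probability one and \<open>not_hegemonic\<close> that it has probability zero. In both cases the process
  runs from almost every realisation \<open>P\<close> of the random initial configuration; its randomness lives
  on the sample type \<open>'w\<close>.
\<close>
definition hegemonic ::
  "'w itself \<Rightarrow> (region \<Rightarrow> region \<Rightarrow> real) \<Rightarrow> config measure \<Rightarrow> bool"
where
  "hegemonic _ rate \<mu> \<longleftrightarrow>
     (AE P in \<mu>. \<forall>(M :: 'w measure) X. empire_process rate P M X \<longrightarrow>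
        (AE \<omega> in M. infinite_region_appears X \<omega>))"

definition not_hegemonic ::
  "'w itself \<Rightarrow> (region \<Rightarrow> region \<Rightarrow> real) \<Rightarrow> config measure \<Rightarrow> bool"
where
  "not_hegemonic _ rate \<mu> \<longleftrightarrow>
     (AE P in \<mu>. \<forall>(M :: 'w measure) X. empire_process rate P M X \<longrightarrow>
        (AE \<omega> in M. \<not> infinite_region_appears X \<omega>))"

text \<open>
  The presumption that the choice of initial configuration, within a class \<open>I\<close>, does not affect
  hegemony.
\<close>
definition initial_choice_irrelevant ::
  "'w itself \<Rightarrow> (region \<Rightarrow> region \<Rightarrow> real) \<Rightarrow> config measure set \<Rightarrow> bool"
where
  "initial_choice_irrelevant w rate I \<longleftrightarrow>
     (\<forall>\<mu>\<in>I. \<forall>\<nu>\<in>I. hegemonic w rate \<mu> \<longleftrightarrow> hegemonic w rate \<nu>)"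

end

theory Submission
  imports Defs "HOL-Library.Transitive_Closure_Table"
begin

text \<open>
  Both parts compare the process at a fixed time in large finite windows with a deterministic
  quantity, uniformly in the window, and then let the windows exhaust the plane. In a window the
  process has finitely many states, so the infinitesimal description yields a Gronwall estimate
  (\<open>expectation_bound\<close>): if the generator satisfies \<open>L f \<le> a f\<close> for a nonnegative function \<open>f\<close> of
  the configuration, then the expectation of \<open>f\<close> at time \<open>t\<close> is at most \<open>exp (a t)\<close> times its
  initial value. An event that holds in all large windows inherits any probability bound that the
  windows share (\<open>eventually_event_cover\<close>).

  Not hegemonic. Take \<open>f\<close> to be the perimeter of the region that contains a given initial
  cell. Since \<open>peri (A \<union> B) \<le> peri A + peri B\<close>, the assumption gives \<open>L f \<le> max C 0 * f\<close>
  (\<open>perimeter_drift\<close>), so the expected perimeter grows at most exponentially, uniformly in the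
  window. A connected region that reaches far away has a long perimeter, as its frontier projects
  onto a long interval (\<open>width_le_peri\<close>). By Markov's inequality the region of the given cell is
  therefore almost surely bounded in the limit. There are countably many cells, and regions only
  grow with time, so it suffices to look at integer times.

  Hegemonic. By the irrelevance of the initial configuration it suffices to treat the square grid.
  Call a grid edge closed at time \<open>t\<close> if its two cells are in different regions. While all edges of
  a finite set \<open>E\<close> are closed, they contribute at least \<open>card E / 2\<close> to the total length of common
  boundaries, hence mergers that open one of them happen at total rate at least \<open>c * card E / 2\<close>.
  With the indicator of ``all of \<open>E\<close> closed'' as \<open>f\<close>, the Gronwall estimate bounds the probability
  that all of \<open>E\<close> is closed by \<open>q ^ card E\<close> with \<open>q = exp (- c t / 2)\<close> (\<open>closed_edges_cover\<close>). This
  replaces independence in a Peierls argument. If the region of the cell at the origin is finite,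
  then among the closed edges surrounding it there is, for some \<open>j\<close>, a path of \<open>j + 1\<close>
  distinct edges that starts at the edge from \<open>(j, 0)\<close> to \<open>(j + 1, 0)\<close>, consecutive edges lying
  on a common face of the lattice (\<open>surrounding_edge_path\<close>). There are at most \<open>8 ^ j\<close>
  such paths, so this has probability at most \<open>q * (\<Sum>j. (8 q) ^ j)\<close>, which tends to 0 as \<open>t\<close> grows.
  An infinite region thus exists at some time with probability one.

  The surrounding path comes from a parity argument. A finite set of edges that meets every
  lattice face in an even number of edges crosses every row an even number of times, because
  consecutive rows have the same parity and far rows have none (\<open>even_card_row\<close>). Apply this to the
  part of the boundary of the cluster connected, through common faces, to the positive axis.
  The boundary meets the positive axis an odd number of times, so this part must meet the
  negative axis as well.
\<close>

section \<open>One-dimensional Hausdorff measure in the plane\<close>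

text \<open>
  The infimum inside \<^const>\<open>curve_length\<close> at one fixed mesh. Lower bounds on the length need only a
  single mesh, upper bounds need all of them.
\<close>
definition cover_length :: "real \<Rightarrow> plane set \<Rightarrow> ennreal" where
  "cover_length d S =
     (INF U\<in>{U :: nat \<Rightarrow> plane set. S \<subseteq> (\<Union>i. U i) \<and> (\<forall>i. bounded (U i) \<and> diameter (U i) \<le> d)}.
        (\<Sum>i. ennreal (diameter (U i))))"

lemma curve_length_cover_length: "curve_length S = (SUP d\<in>{0<..}. cover_length d S)"
  unfolding curve_length_def cover_length_def ..

lemma cover_length_le_curve_length: "0 < d \<Longrightarrow> cover_length d S \<le> curve_length S"
  unfolding curve_length_cover_length by (rule SUP_upper) simp

lemma curve_length_mono:
  assumes "S \<subseteq> T" shows "curve_length S \<le> curve_length T"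
  unfolding curve_length_cover_length cover_length_def
  by (intro SUP_mono' INF_superset_mono) (use assms in auto)

text \<open>
  Two countable covers are merged into one by putting them at the even and at the odd indices.
\<close>
lemma suminf_interleave:
  fixes f g :: "nat \<Rightarrow> ennreal"
  shows "(\<Sum>i. if even i then f (i div 2) else g (i div 2)) = (\<Sum>i. f i) + (\<Sum>i. g i)"
proof -
  have "(\<Sum>i. if even i then f (i div 2) else g (i div 2)) =
      (\<Sum>i. (if even i then f (i div 2) else 0) + (if odd i then g (i div 2) else 0))"
    by (rule suminf_cong) auto
  also have "\<dots> = (\<Sum>i. if even i then f (i div 2) else 0) + (\<Sum>i. if odd i then g (i div 2) else 0)"
    by (rule suminf_add[symmetric]) auto
  also have "(\<Sum>i. if even i then f (i div 2) else 0) = (\<Sum>i. f i)"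
    using suminf_mono_reindex[of "\<lambda>i. 2 * i" "\<lambda>i. if even i then f (i div 2) else 0"]
    by (fastforce simp: strict_mono_def elim: evenE)
  also have "(\<Sum>i. if odd i then g (i div 2) else 0) = (\<Sum>i. g i)"
    using suminf_mono_reindex[of "\<lambda>i. 2 * i + 1" "\<lambda>i. if odd i then g (i div 2) else 0"]
    by (fastforce simp: strict_mono_def elim: oddE)
  finally show ?thesis .
qed

lemma curve_length_Un: "curve_length (S \<union> T) \<le> curve_length S + curve_length T"
  unfolding curve_length_cover_length[of "S \<union> T"]
proof (rule SUP_least)
  fix d :: real assume "d \<in> {0<..}"
  then have d: "0 < d" by simp
  have "cover_length d (S \<union> T) \<le> cover_length d S + cover_length d T"
  proof (rule ennreal_le_epsilon)
    fix e :: real assume fin: "cover_length d S + cover_length d T < top" and e: "0 < e"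
    have "cover_length d S < cover_length d S + ennreal (e / 2)"
      using fin e by (simp add: ennreal_add_left_cancel_less less_top)
    then obtain U where U: "S \<subseteq> (\<Union>i. U i)" "\<And>i. bounded (U i) \<and> diameter (U i) \<le> d"
        "(\<Sum>i. ennreal (diameter (U i))) < cover_length d S + ennreal (e / 2)"
      unfolding cover_length_def[of d S] by (auto simp: INF_less_iff)
    have "cover_length d T < cover_length d T + ennreal (e / 2)"
      using fin e by (simp add: ennreal_add_left_cancel_less less_top)
    then obtain V where V: "T \<subseteq> (\<Union>i. V i)" "\<And>i. bounded (V i) \<and> diameter (V i) \<le> d"
        "(\<Sum>i. ennreal (diameter (V i))) < cover_length d T + ennreal (e / 2)"
      unfolding cover_length_def[of d T] by (auto simp: INF_less_iff)
    define Y where "Y i = (if even i then U (i div 2) else V (i div 2))" for i :: nat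
    have "S \<union> T \<subseteq> (\<Union>i. Y i)"
    proof
      fix x assume "x \<in> S \<union> T"
      then obtain i where "x \<in> U i \<or> x \<in> V i" using U(1) V(1) by auto
      then have "x \<in> Y (2 * i) \<or> x \<in> Y (2 * i + 1)" by (auto simp: Y_def)
      then show "x \<in> (\<Union>i. Y i)" by blast
    qed
    then have "cover_length d (S \<union> T) \<le> (\<Sum>i. ennreal (diameter (Y i)))"
      unfolding cover_length_def by (intro INF_lower) (use U(2) V(2) in \<open>auto simp: Y_def\<close>)
    also have "(\<lambda>i. ennreal (diameter (Y i))) = (\<lambda>i. if even i then ennreal (diameter (U (i div 2)))
                 else ennreal (diameter (V (i div 2))))"
      by (auto simp: Y_def)
    also have "(\<Sum>i. if even i then ennreal (diameter (U (i div 2)))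
                 else ennreal (diameter (V (i div 2)))) =
               (\<Sum>i. ennreal (diameter (U i))) + (\<Sum>i. ennreal (diameter (V i)))"
      by (rule suminf_interleave)
    also have "\<dots> \<le> (cover_length d S + ennreal (e / 2)) + (cover_length d T + ennreal (e / 2))"
      by (intro add_mono less_imp_le U V)
    also have "\<dots> = cover_length d S + cover_length d T + ennreal e"
      using ennreal_plus[of "e / 2" "e / 2"] e by (simp add: ac_simps del: ennreal_plus)
    finally show "cover_length d (S \<union> T) \<le> cover_length d S + cover_length d T + ennreal e" .
  qed
  also have "\<dots> \<le> curve_length S + curve_length T"
    by (intro add_mono cover_length_le_curve_length d)
  finally show "cover_length d (S \<union> T) \<le> curve_length S + curve_length T" .
qed

lemma curve_length_empty: "curve_length {} = 0"
proof -
  have "cover_length d {} \<le> 0" if "0 < d" for d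
    unfolding cover_length_def by (rule INF_lower2[of "\<lambda>_. {}"]) (use that in auto)
  then show ?thesis unfolding curve_length_cover_length by (auto simp: SUP_constant intro!: antisym SUP_least)
qed

lemma curve_length_Union_finite:
  assumes "finite F" "\<And>S. S \<in> F \<Longrightarrow> curve_length S < \<infinity>"
  shows "curve_length (\<Union>F) < \<infinity>"
  using assms
proof (induction F rule: finite_induct)
  case (insert S F)
  have "curve_length (\<Union>(insert S F)) \<le> curve_length S + curve_length (\<Union>F)"
    using curve_length_Un by simp
  also have "\<dots> < \<infinity>" using insert by simp
  finally show ?case .
qed (simp add: curve_length_empty)

lemma diameter_closed_segment_le:
  fixes a b :: "'a::euclidean_space"
  shows "diameter (closed_segment a b) \<le> dist a b"
proof (intro diameter_le)
  fix x y assume "x \<in> closed_segment a b" "y \<in> closed_segment a b"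
  then show "norm (x - y) \<le> dist a b"
    using segment_furthest_le[of y a b x] segment_bound[of x a b]
    by (force simp: dist_norm norm_minus_commute)
qed simp

text \<open>
  Cutting the segment into equal pieces gives covers of arbitrarily small mesh and constant total
  diameter.
\<close>
lemma curve_length_segment:
  fixes a b :: plane
  shows "curve_length (closed_segment a b) < \<infinity>"
proof -
  have "cover_length d (closed_segment a b) \<le> ennreal (dist a b)" if d: "0 < d" for d
  proof -
    obtain m :: nat where m: "dist a b / d < real m" using reals_Archimedean2 by blast
    with d have m0: "0 < m" by (cases m) (auto simp: divide_less_0_iff not_less[symmetric])
    define x where "x k = a + (real k / real m) *\<^sub>R (b - a)" for k :: nat
    define U where "U k = (if k < m then closed_segment (x k) (x (Suc k)) else {})" for k
    have step: "dist (x k) (x (Suc k)) = dist a b / real m" for k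
    proof -
      have "x (Suc k) - x k = (1 / real m) *\<^sub>R (b - a)"
        by (simp add: x_def add_divide_distrib scaleR_add_left)
      then show ?thesis by (metis dist_norm norm_minus_commute norm_scaleR abs_of_nonneg divide_inverse_commute
          inverse_eq_divide of_nat_0_le_iff zero_le_divide_1_iff)
    qed
    have dU: "diameter (U k) \<le> (if k < m then dist a b / real m else 0)" for k
      using diameter_closed_segment_le[of "x k" "x (Suc k)"] by (simp add: U_def step)
    have "closed_segment a b \<subseteq> (\<Union>i. U i)"
    proof
      fix y assume "y \<in> closed_segment a b"
      then obtain u where u: "0 \<le> u" "u \<le> 1" "y = a + u *\<^sub>R (b - a)"
        by (auto simp: closed_segment_def algebra_simps)
      \<comment> \<open>The minimum puts the endpoint \<open>u = 1\<close> into the last piece.\<close>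
      define k where "k = min (nat \<lfloor>u * real m\<rfloor>) (m - 1)"
      have k: "k < m" using m0 by (auto simp: k_def)
      have lo: "real k \<le> u * real m" using u by (auto simp: k_def min_def le_nat_floor) linarith+
      have hi: "u * real m \<le> real k + 1"
      proof (cases "nat \<lfloor>u * real m\<rfloor> \<le> m - 1")
        case True
        then have "real k = real_of_int \<lfloor>u * real m\<rfloor>" using u by (simp add: k_def)
        then show ?thesis by linarith
      next
        case False
        then have "real k + 1 = real m" using m0 by (simp add: k_def)
        then show ?thesis using u mult_right_mono[of u 1 "real m"] by simp
      qed
      define v where "v = u * real m - real k"
      have "y = (1 - v) *\<^sub>R x k + v *\<^sub>R x (Suc k)"
      proof -
        have "(1 - v) *\<^sub>R x k + v *\<^sub>R x (Suc k) = x k + v *\<^sub>R (x (Suc k) - x k)" by (simp add: algebra_simps)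
        also have "x (Suc k) - x k = (1 / real m) *\<^sub>R (b - a)"
          by (simp add: x_def add_divide_distrib scaleR_add_left)
        also have "x k + v *\<^sub>R ((1 / real m) *\<^sub>R (b - a)) = a + ((real k + v) / real m) *\<^sub>R (b - a)"
          by (simp add: x_def add_divide_distrib scaleR_add_left)
        also have "(real k + v) / real m = u" using m0 by (simp add: v_def)
        finally show ?thesis using u by simp
      qed
      then have "y \<in> closed_segment (x k) (x (Suc k))"
        using lo hi by (auto simp: closed_segment_def v_def intro!: exI[of _ v])
      then show "y \<in> (\<Union>i. U i)" using k by (auto simp: U_def)
    qed
    moreover have "bounded (U i) \<and> diameter (U i) \<le> d" for i
    proof -
      have "dist a b / real m \<le> d" using m d m0 by (simp add: field_simps)
      then have "diameter (U i) \<le> d" using d dU[of i] by (auto split: if_splits)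
      then show ?thesis by (auto simp: U_def compact_imp_bounded)
    qed
    ultimately have "cover_length d (closed_segment a b) \<le> (\<Sum>i. ennreal (diameter (U i)))"
      unfolding cover_length_def by (intro INF_lower) auto
    also have "\<dots> = (\<Sum>i<m. ennreal (diameter (U i)))"
      by (rule suminf_finite) (auto simp: U_def)
    also have "\<dots> \<le> (\<Sum>i<m. ennreal (dist a b / real m))"
      by (intro sum_mono ennreal_leI) (metis dU lessThan_iff)
    also have "\<dots> = ennreal (dist a b)" using m0 by (simp add: ennreal_of_nat_eq_real_of_nat flip: ennreal_mult)
    finally show ?thesis .
  qed
  then have "curve_length (closed_segment a b) \<le> ennreal (dist a b)"
    unfolding curve_length_cover_length by (auto intro!: SUP_least)
  also have "\<dots> < \<infinity>" by simp
  finally show ?thesis .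
qed

text \<open>
  A coordinate projection sends a set of diameter \<open>D\<close> into an interval of length \<open>D\<close>. The intervals
  obtained from a cover of \<open>S\<close> cover \<open>{a..b}\<close>, so countable subadditivity of Lebesgue measure applies.
\<close>
lemma projection_le_cover:
  fixes U :: "nat \<Rightarrow> plane set"
  assumes ab: "a \<le> b" and proj: "\<And>s. a \<le> s \<Longrightarrow> s \<le> b \<Longrightarrow> \<exists>x\<in>S. x $ i = s"
    and cov: "S \<subseteq> (\<Union>k. U k)" and bdd: "\<And>k. bounded (U k)"
  shows "ennreal (b - a) \<le> (\<Sum>k. ennreal (diameter (U k)))"
proof -
  define V where "V k = (\<lambda>x. x $ i) ` U k" for k
  define J where "J k = (if U k = {} then {} else {Inf (V k) .. Inf (V k) + diameter (U k)})" for k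
  have UJ: "x $ i \<in> J k" if x: "x \<in> U k" for x k
  proof -
    have "bounded (V k)" unfolding V_def using bdd bounded_linear_image bounded_linear_vec_nth by blast
    then have "bdd_below (V k)" by (rule bounded_imp_bdd_below)
    then have "Inf (V k) \<le> x $ i" using x by (intro cInf_lower) (auto simp: V_def)
    moreover have "x $ i - diameter (U k) \<le> Inf (V k)"
    proof (rule cInf_greatest)
      show "V k \<noteq> {}" using x by (auto simp: V_def)
      fix y assume "y \<in> V k"
      then obtain z where z: "z \<in> U k" "y = z $ i" by (auto simp: V_def)
      have "x $ i - z $ i \<le> dist x z"
        using component_le_norm_cart[of "x - z" i] by (simp add: dist_norm)
      also have "\<dots> \<le> diameter (U k)" by (rule diameter_bounded_bound[OF bdd x z(1)])
      finally show "x $ i - diameter (U k) \<le> y" using z by simp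
    qed
    ultimately show ?thesis using x by (auto simp: J_def)
  qed
  have [measurable]: "J k \<in> sets borel" for k by (simp add: J_def)
  have "ennreal (b - a) = emeasure lborel {a..b}" using ab by simp
  also have "\<dots> \<le> emeasure lborel (\<Union>k. J k)"
  proof (rule emeasure_mono)
    show "{a..b} \<subseteq> (\<Union>k. J k)" using proj cov UJ by (force simp: subset_iff)
  qed simp
  also have "\<dots> \<le> (\<Sum>k. emeasure lborel (J k))"
    by (rule emeasure_subadditive_countably) auto
  also have "\<dots> = (\<Sum>k. ennreal (diameter (U k)))"
    by (rule suminf_cong) (auto simp: J_def diameter_ge_0 bdd)
  finally show ?thesis .
qed

text \<open>
  The lower bound for lengths behind both parts. At a mesh below the separation distance each member
  of a cover meets at most one of the pieces \<open>T e\<close>, so the bounds for the single pieces add up. With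
  one piece this bounds the perimeter of a wide region, with many pieces the length of a
  common boundary made of many grid edges.
\<close>
lemma sum_projections_le_curve_length:
  fixes T :: "'e \<Rightarrow> plane set"
  assumes E: "finite E" and sub: "\<And>e. e \<in> E \<Longrightarrow> T e \<subseteq> S" and l: "0 \<le> l" and \<delta>: "0 < \<delta>"
    and proj: "\<And>e. e \<in> E \<Longrightarrow> \<exists>i a. \<forall>s. a \<le> s \<and> s \<le> a + l \<longrightarrow> (\<exists>x\<in>T e. x $ i = s)"
    and sep: "\<And>e e' x y. e \<in> E \<Longrightarrow> e' \<in> E \<Longrightarrow> e \<noteq> e' \<Longrightarrow> x \<in> T e \<Longrightarrow> y \<in> T e' \<Longrightarrow> \<delta> \<le> dist x y"
  shows "ennreal (real (card E) * l) \<le> curve_length S"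
proof -
  have "ennreal (real (card E) * l) \<le> cover_length (\<delta> / 2) S"
    unfolding cover_length_def
  proof (rule INF_greatest, clarify)
    fix U :: "nat \<Rightarrow> plane set"
    assume cov: "S \<subseteq> (\<Union>i. U i)" and U: "\<forall>i. bounded (U i) \<and> diameter (U i) \<le> \<delta> / 2"
    define V where "V e i = (if U i \<inter> T e = {} then {} else U i)" for e i
    have one: "(\<Sum>e\<in>E. ennreal (diameter (V e i))) \<le> ennreal (diameter (U i))" for i
    proof (cases "\<exists>e\<in>E. U i \<inter> T e \<noteq> {}")
      case True
      then obtain e x where e: "e \<in> E" "x \<in> U i" "x \<in> T e" by auto
      have "V e' i = {}" if "e' \<in> E" "e' \<noteq> e" for e'
      proof (rule ccontr)
        assume "V e' i \<noteq> {}"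
        then obtain y where y: "y \<in> U i" "y \<in> T e'" by (auto simp: V_def split: if_splits)
        have "\<delta> \<le> dist x y" using sep[of e e' x y] that e y by auto
        moreover have "dist x y \<le> diameter (U i)" by (rule diameter_bounded_bound) (use U e y in auto)
        moreover have "diameter (U i) \<le> \<delta> / 2" using U by blast
        ultimately show False using \<delta> by linarith
      qed
      then have "(\<Sum>e'\<in>E. ennreal (diameter (V e' i))) = (\<Sum>e'\<in>{e}. ennreal (diameter (V e' i)))"
        by (intro sum.mono_neutral_right) (use E e in auto)
      also have "\<dots> \<le> ennreal (diameter (U i))" by (simp add: V_def)
      finally show ?thesis .
    next
      case False
      then have "V e i = {}" if "e \<in> E" for e using that by (auto simp: V_def)
      then show ?thesis by simp
    qed
    have "ennreal (real (card E) * l) = (\<Sum>e\<in>E. ennreal l)"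
      using l by (simp add: ennreal_mult ennreal_of_nat_eq_real_of_nat)
    also have "\<dots> \<le> (\<Sum>e\<in>E. \<Sum>i. ennreal (diameter (V e i)))"
    proof (rule sum_mono)
      fix e assume e: "e \<in> E"
      obtain j a where p: "\<And>s. a \<le> s \<Longrightarrow> s \<le> a + l \<Longrightarrow> \<exists>x\<in>T e. x $ j = s" using proj[OF e] by blast
      have "T e \<subseteq> (\<Union>i. V e i)" using cov sub[OF e] by (fastforce simp: V_def)
      then show "ennreal l \<le> (\<Sum>i. ennreal (diameter (V e i)))"
        using projection_le_cover[of a "a + l" "T e" j "V e"] l p U by (auto simp: V_def)
    qed
    also have "\<dots> = (\<Sum>i. \<Sum>e\<in>E. ennreal (diameter (V e i)))" by (rule suminf_sum[symmetric]) simp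
    also have "\<dots> \<le> (\<Sum>i. ennreal (diameter (U i)))" by (rule suminf_le) (auto intro: one)
    finally show "ennreal (real (card E) * l) \<le> (\<Sum>i. ennreal (diameter (U i)))" .
  qed
  also have "\<dots> \<le> curve_length S" using \<delta> by (intro cover_length_le_curve_length) simp
  finally show ?thesis .
qed

section \<open>Polygonal regions\<close>

lemma polygonal_compact: "polygonal A \<Longrightarrow> compact A"
  unfolding polygonal_def using compact_Union polytope_imp_compact by metis

lemma polygonal_closed: "polygonal A \<Longrightarrow> closed A"
  by (simp add: polygonal_compact compact_imp_closed)

text \<open>
  Regions have no lower-dimensional parts. This is what turns disjointness of interiors into the
  rigidity of tessellations below.
\<close>
lemma polygonal_closure_interior:
  assumes "polygonal A" shows "closure (interior A) = A"
proof
  show "closure (interior A) \<subseteq> A"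
    using assms by (metis polygonal_closed closure_minimal interior_subset)
  obtain F where F: "\<And>K. K \<in> F \<Longrightarrow> polytope K \<and> interior K \<noteq> {}" "A = \<Union>F"
    using assms unfolding polygonal_def by blast
  show "A \<subseteq> closure (interior A)"
  proof
    fix x assume "x \<in> A"
    then obtain K where K: "K \<in> F" "x \<in> K" using F by blast
    have "closure (interior K) = closure K"
      using F(1)[OF K(1)] convex_closure_interior polytope_imp_convex by blast
    then have "x \<in> closure (interior K)" using K(2) closure_subset by blast
    also have "closure (interior K) \<subseteq> closure (interior A)"
      using K F by (intro closure_mono interior_mono) auto
    finally show "x \<in> closure (interior A)" .
  qed
qed

lemma polygonal_interior_nonempty:
  assumes "polygonal A" shows "interior A \<noteq> {}"
proof -
  have "A \<noteq> {}" using assms unfolding polygonal_def by (metis Union_upper all_not_in_conv interior_subset subset_empty)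
  then show ?thesis using polygonal_closure_interior[OF assms] by auto
qed

lemma polygonal_nonempty: "polygonal A \<Longrightarrow> A \<noteq> {}"
  using polygonal_interior_nonempty interior_subset by blast

lemma polygonal_Un:
  assumes "polygonal A" "polygonal B" "A \<inter> B \<noteq> {}"
  shows "polygonal (A \<union> B)"
proof -
  obtain F where F: "finite F" "F \<noteq> {}" "\<forall>K\<in>F. polytope K \<and> interior K \<noteq> {}" "A = \<Union>F"
    using assms(1) unfolding polygonal_def by blast
  obtain G where G: "finite G" "\<forall>K\<in>G. polytope K \<and> interior K \<noteq> {}" "B = \<Union>G"
    using assms(2) unfolding polygonal_def by blast
  have "connected (A \<union> B)"
    using assms by (intro connected_Un) (auto simp: polygonal_def)
  with F G show ?thesis
    unfolding polygonal_def by (intro conjI exI[of _ "F \<union> G"]) auto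
qed

text \<open>
  The frontier of a planar polytope with nonempty interior is the union of its finitely many facets,
  and these are segments.
\<close>
lemma polytope_frontier_length:
  fixes K :: "plane set"
  assumes K: "polytope K" "interior K \<noteq> {}"
  shows "curve_length (frontier K) < \<infinity>"
proof -
  have aff: "aff_dim K = 2" using aff_dim_nonempty_interior[OF K(2)] by simp
  have "frontier K = rel_frontier K"
    by (rule rel_frontier_nonempty_interior[symmetric, OF K(2)])
  also have "\<dots> = \<Union>{G. G facet_of K}"
    using K(1) by (intro rel_frontier_of_polyhedron polytope_imp_polyhedron)
  finally have fr: "frontier K = \<Union>{G. G facet_of K}" .
  have "curve_length G < \<infinity>" if "G facet_of K" for G
  proof -
    have p: "polytope G" using that K(1) by (simp add: face_of_polytope_polytope facet_of_imp_face_of)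
    have "aff_dim G = 1" using that aff by (simp add: facet_of_def)
    then have "collinear G" by (simp add: collinear_aff_dim)
    moreover have "G \<noteq> {}" using that by (simp add: facet_of_def)
    ultimately obtain a b where "G = closed_segment a b"
      using p by (metis compact_convex_collinear_segment polytope_imp_compact polytope_imp_convex)
    then show ?thesis using curve_length_segment by simp
  qed
  then show ?thesis unfolding fr
    by (intro curve_length_Union_finite finite_polytope_facets K(1)) auto
qed

lemma peri_finite:
  assumes "polygonal A" shows "peri A < \<infinity>"
proof -
  obtain F where F: "finite F" "\<forall>K\<in>F. polytope K \<and> interior K \<noteq> {}" "A = \<Union>F"
    using assms unfolding polygonal_def by blast
  have "frontier A \<subseteq> \<Union>(frontier ` F)" unfolding F(3) using frontier_Union_subset[OF F(1)] by auto
  then have "peri A \<le> curve_length (\<Union>(frontier ` F))" unfolding peri_def by (rule curve_length_mono)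
  also have "\<dots> < \<infinity>" using F polytope_frontier_length by (intro curve_length_Union_finite) auto
  finally show ?thesis .
qed

lemma peri_Un: "peri (A \<union> B) \<le> peri A + peri B"
  unfolding peri_def
  by (rule order_trans[OF curve_length_mono[OF frontier_Un_subset] curve_length_Un])

text \<open>
  A vertical or horizontal line through a point of the bounded region \<open>R\<close> leaves \<open>R\<close>, hence meets
  its frontier. By connectedness there is such a point over every value between the coordinates
  of \<open>x\<close> and \<open>y\<close>, so the projection of the frontier covers the whole interval between them.
\<close>
lemma width_le_peri:
  fixes R :: region
  assumes R: "connected R" "bounded R" and x: "x \<in> R" and y: "y \<in> R"
  shows "ennreal (y $ i - x $ i) \<le> peri R"
proof (cases "x $ i \<le> y $ i")
  case True
  \<comment> \<open>Lines in the direction of the other axis have constant \<open>i\<close>-th coordinate.\<close>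
  obtain j :: 2 where j: "j \<noteq> i" by (metis one_neq_zero)
  have "\<exists>z\<in>frontier R. z $ i = s" if s: "x $ i \<le> s" "s \<le> y $ i" for s
  proof -
    obtain p where p: "p \<in> R" "p $ i = s"
      using connected_ivt_component_cart[OF R(1) x y s] by blast
    define T where "T = range (\<lambda>t :: real. p + t *\<^sub>R axis j 1)"
    have "connected T" unfolding T_def by (intro connected_continuous_image continuous_intros) auto
    moreover have "T \<inter> R \<noteq> {}" using p(1) by (auto simp: T_def intro!: image_eqI[of _ _ 0])
    moreover have "T - R \<noteq> {}"
    proof
      assume "T - R = {}"
      then have "bounded T" using R(2) bounded_subset by blast
      then obtain b where b: "\<And>z. z \<in> T \<Longrightarrow> norm z \<le> b" by (auto simp: bounded_iff)
      have "p + (b + norm p + 1) *\<^sub>R axis j 1 \<in> T" by (auto simp: T_def)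
      from b[OF this] have "norm ((b + norm p + 1) *\<^sub>R (axis j 1 :: plane)) - norm p \<le> b"
        by (metis add.commute norm_diff_ineq order_trans)
      then show False using b[of p] norm_ge_zero[of p] by (auto simp: T_def norm_axis_1)
    qed
    ultimately have "T \<inter> frontier R \<noteq> {}" by (rule connected_Int_frontier)
    then obtain t where "p + t *\<^sub>R axis j 1 \<in> frontier R" by (auto simp: T_def)
    moreover have "(p + t *\<^sub>R axis j 1) $ i = s" using p j by (simp add: axis_def)
    ultimately show ?thesis by blast
  qed
  then have "ennreal (real (card {()}) * (y $ i - x $ i)) \<le> curve_length (frontier R)"
    by (intro sum_projections_le_curve_length[where T = "\<lambda>_. frontier R" and \<delta> = 1])
      (use True in \<open>auto intro!: exI[of _ i] exI[of _ "x $ i"]\<close>)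
  then show ?thesis by (simp add: peri_def)
qed (simp add: ennreal_neg)

lemma common_length_pos_imp_meet:
  assumes "common_length A B > 0" "closed A" "closed B" shows "A \<inter> B \<noteq> {}"
proof
  assume "A \<inter> B = {}"
  then have "frontier A \<inter> frontier B = {}"
    using assms(2,3) frontier_subset_closed by blast
  with assms(1) show False by (simp add: common_length_def curve_length_empty)
qed

lemma common_length_commute: "common_length A B = common_length B A"
  by (simp add: common_length_def Int_commute)

lemma non_overlapping_commute: "non_overlapping A B \<longleftrightarrow> non_overlapping B A"
  by (auto simp: non_overlapping_def)

text \<open>
  The part outside \<open>B\<close> of an open set \<open>V\<close> inside \<open>(A \<union> B) \<inter> C\<close> is open and lies in \<open>A \<inter> C\<close>, hence is
  empty. So \<open>V\<close> lies in \<open>B \<inter> C\<close> and is empty as well.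
\<close>
lemma interior_Un_Int_empty:
  assumes "closed B" "interior A \<inter> interior C = {}" "interior B \<inter> interior C = {}"
  shows "interior (A \<union> B) \<inter> interior C = {}"
proof -
  define V where "V = interior (A \<union> B) \<inter> interior C"
  have V: "open V" "V \<subseteq> A \<union> B" "V \<subseteq> C" using interior_subset by (auto simp: V_def)
  have "V - B \<subseteq> interior A" "V - B \<subseteq> interior C"
    using V assms(1) by (auto intro!: interior_maximal[THEN subsetD, of "V - B"])
  with assms(2) have "V \<subseteq> B" by blast
  then have "V \<subseteq> interior B" "V \<subseteq> interior C" using V by (simp_all add: interior_maximal)
  with assms(3) show ?thesis by (auto simp: V_def)
qed

lemma non_overlapping_Un:
  "\<lbrakk>closed B; non_overlapping A C; non_overlapping B C\<rbrakk> \<Longrightarrow> non_overlapping (A \<union> B) C"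
  unfolding non_overlapping_def by (rule interior_Un_Int_empty)

lemma tessellation_eqI:
  assumes P: "tessellation P" "A \<in> P" "B \<in> P" and x: "x \<in> interior A" "x \<in> B"
  shows "A = B"
proof (rule ccontr)
  assume "A \<noteq> B"
  then have "interior A \<inter> interior B = {}"
    using P by (auto simp: tessellation_def pairwise_def non_overlapping_def)
  then have "interior A \<inter> closure (interior B) = {}"
    by (simp add: open_Int_closure_eq_empty)
  moreover have "closure (interior B) = B" using P by (simp add: tessellation_def polygonal_closure_interior)
  ultimately show False using x by blast
qed

lemma tessellation_subset_eqI:
  assumes P: "tessellation P" "A \<in> P" "B \<in> P" and C: "polygonal C" "C \<subseteq> A" "C \<subseteq> B"
  shows "A = B"
proof -
  obtain x where "x \<in> interior C" using polygonal_interior_nonempty[OF C(1)] by blast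
  then have "x \<in> interior A" "x \<in> B" using C interior_mono interior_subset by blast+
  then show ?thesis using tessellation_eqI P by blast
qed

text \<open>
  A region inside a union of regions of the same tessellation is one of them, although the union is a
  mere set of points. This allows mergers to be followed on the level of point sets.
\<close>
lemma tessellation_subset_Union:
  assumes P: "tessellation P" "A \<in> P" "F \<subseteq> P" "A \<subseteq> \<Union>F"
  shows "A \<in> F"
proof -
  obtain x where x: "x \<in> interior A" using polygonal_interior_nonempty[of A] P(1,2) by (auto simp: tessellation_def)
  then have "x \<in> \<Union>F" using P(4) interior_subset by blast
  then obtain B where "B \<in> F" "x \<in> B" by blast
  then show ?thesis using tessellation_eqI[OF P(1,2) _ x] P(3) by blast
qed

lemma tessellation_countable:
  assumes "tessellation P" shows "countable P"
proof -
  have "P \<subseteq> (\<Union>n::nat. {A\<in>P. A \<inter> cball 0 (real n) \<noteq> {}})"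
  proof
    fix A assume A: "A \<in> P"
    then obtain x where "x \<in> A" using assms polygonal_nonempty by (force simp: tessellation_def)
    moreover obtain n where "norm x \<le> real n" using real_arch_simple by blast
    ultimately show "A \<in> (\<Union>n::nat. {A\<in>P. A \<inter> cball 0 (real n) \<noteq> {}})" using A by force
  qed
  moreover have "countable (\<Union>n::nat. {A\<in>P. A \<inter> cball 0 (real n) \<noteq> {}})"
    using assms by (intro countable_UN) (auto simp: tessellation_def countable_finite)
  ultimately show ?thesis by (rule countable_subset)
qed

lemma tessellation_finite_bounded:
  assumes "tessellation P" shows "finite {A\<in>P. A \<subseteq> cball 0 r}"
proof (rule finite_subset)
  show "{A\<in>P. A \<subseteq> cball 0 r} \<subseteq> {A\<in>P. A \<inter> cball 0 r \<noteq> {}}"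
  proof clarify
    fix A assume A: "A \<in> P" "A \<subseteq> cball 0 r" "A \<inter> cball 0 r = {}"
    then have "A = {}" by blast
    with A(1) assms show False using polygonal_nonempty[of A] by (simp add: tessellation_def)
  qed
  show "finite {A\<in>P. A \<inter> cball 0 r \<noteq> {}}" using assms by (simp add: tessellation_def)
qed

lemma finite_neighbours:
  assumes "tessellation P" "A \<in> P" shows "finite (neighbours P A)"
proof -
  obtain r where r: "A \<subseteq> cball 0 r"
    using assms polygonal_compact compact_imp_bounded bounded_subset_ballD[of A 0] ball_subset_cball
    by (metis subset_trans tessellation_def)
  have "neighbours P A \<subseteq> {B\<in>P. B \<inter> cball 0 r \<noteq> {}}"
  proof
    fix B assume B: "B \<in> neighbours P A"
    then have "A \<inter> B \<noteq> {}"
      using assms polygonal_closed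
      by (intro common_length_pos_imp_meet) (auto simp: neighbours_def tessellation_def)
    then show "B \<in> {B\<in>P. B \<inter> cball 0 r \<noteq> {}}" using B r by (auto simp: neighbours_def)
  qed
  then show ?thesis using assms by (auto simp: tessellation_def intro: finite_subset)
qed

section \<open>The process in a finite window\<close>

text \<open>
  A finite set of configurations that contains the initial one and is closed under the mergers of
  the window. Cells outside the window stay, all other regions are unions of cells of the window.
\<close>
definition window_states :: "config \<Rightarrow> config \<Rightarrow> config set" where
  "window_states P W =
     {Q. tessellation Q \<and> (\<forall>A\<in>P. \<exists>R\<in>Q. A \<subseteq> R) \<and> (\<exists>Y. Y \<subseteq> Union ` Pow W \<and> Q = (P - W) \<union> Y)}"

definition successors :: "config \<Rightarrow> config \<Rightarrow> config set" where
  "successors W Q = {merge Q A B |A B. may_merge W Q A B}"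

text \<open>
  Different pairs could a priori lead to the same merged configuration. As probabilities are given
  for target configurations, a representative pair is fixed for each target and its rate is used.
\<close>
definition merging_pair :: "config \<Rightarrow> config \<Rightarrow> config \<Rightarrow> region \<times> region" where
  "merging_pair W Q Q' = (SOME (A, B). may_merge W Q A B \<and> Q' = merge Q A B)"

definition jump_rate :: "(region \<Rightarrow> region \<Rightarrow> real) \<Rightarrow> config \<Rightarrow> config \<Rightarrow> config \<Rightarrow> real" where
  "jump_rate rate W Q Q' = (case merging_pair W Q Q' of (A, B) \<Rightarrow> rate A B)"

lemma merging_pairE:
  assumes "Q' \<in> successors W Q"
  obtains A B where "merging_pair W Q Q' = (A, B)" "may_merge W Q A B" "Q' = merge Q A B"
proof -
  have "\<exists>p. case p of (A, B) \<Rightarrow> may_merge W Q A B \<and> Q' = merge Q A B"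
    using assms by (auto simp: successors_def)
  from someI_ex[OF this] that show ?thesis
    unfolding merging_pair_def by (auto split: prod.splits)
qed

lemma finite_window_states: "finite W \<Longrightarrow> finite (window_states P W)"
  by (rule finite_subset[of _ "(\<lambda>Y. (P - W) \<union> Y) ` Pow (Union ` Pow W)"])
    (auto simp: window_states_def)

lemma initial_window_state:
  assumes "tessellation P" "W \<subseteq> P" shows "P \<in> window_states P W"
proof -
  have "\<exists>Y. Y \<subseteq> Union ` Pow W \<and> P = (P - W) \<union> Y"
    using assms(2) by (intro exI[of _ W]) (auto intro!: image_eqI[of _ Union "{_}"])
  then show ?thesis using assms by (auto simp: window_states_def)
qed

lemma window_state_tessellation: "Q \<in> window_states P W \<Longrightarrow> tessellation Q"
  by (simp add: window_states_def)

lemma window_state_region: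
  assumes "Q \<in> window_states P W" "A \<in> P" obtains R where "R \<in> Q" "A \<subseteq> R"
  using assms unfolding window_states_def by blast

lemma window_state_region_in_window:
  assumes P: "tessellation P" and Q: "Q \<in> window_states P W" "W \<subseteq> P"
    and A: "A \<in> W" "A \<subseteq> R" "R \<in> Q"
  shows "R \<subseteq> \<Union>W"
proof -
  from Q obtain Y where Y: "Y \<subseteq> Union ` Pow W" "Q = (P - W) \<union> Y" by (auto simp: window_states_def)
  have "R \<notin> P - W"
  proof
    assume R: "R \<in> P - W"
    have "A \<in> P" "R \<in> P" using A(1) Q(2) R by auto
    moreover have "polygonal A" using \<open>A \<in> P\<close> P by (simp add: tessellation_def)
    ultimately have "A = R" using P A tessellation_subset_eqI[of P A R A] by blast
    with R A show False by simp
  qed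
  with Y A have "R \<in> Union ` Pow W" by blast
  then show ?thesis by auto
qed

lemma merge_window_state:
  assumes P: "tessellation P" "W \<subseteq> P" and Q: "Q \<in> window_states P W" and m: "may_merge W Q A B"
  shows "merge Q A B \<in> window_states P W"
proof -
  have T: "tessellation Q" using Q by (rule window_state_tessellation)
  have AB: "A \<in> Q" "B \<in> Q" "A \<subseteq> \<Union>W" "B \<subseteq> \<Union>W" "common_length A B > 0"
    using m by (auto simp: may_merge_def neighbours_def)
  have poly: "polygonal R" if "R \<in> Q" for R using T that by (simp add: tessellation_def)
  have "tessellation (merge Q A B)"
    unfolding tessellation_def
  proof (intro conjI ballI allI)
    fix R assume "R \<in> merge Q A B"
    moreover have "polygonal (A \<union> B)"
      by (intro polygonal_Un poly AB common_length_pos_imp_meet polygonal_closed)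
    ultimately show "polygonal R" using poly by (auto simp: merge_def)
  next
    have "\<Union>Q = UNIV" using T by (simp add: tessellation_def)
    moreover have "\<Union>Q \<subseteq> \<Union>(merge Q A B)" by (auto simp: merge_def)
    ultimately show "\<Union>(merge Q A B) = UNIV" by auto
  next
    have pw: "pairwise non_overlapping Q" using T by (simp add: tessellation_def)
    have "non_overlapping (A \<union> B) R" if "R \<in> Q - {A, B}" for R
      by (intro non_overlapping_Un polygonal_closed poly AB)
        (use pw that AB in \<open>auto simp: pairwise_def\<close>)
    then show "pairwise non_overlapping (merge Q A B)"
      unfolding merge_def pairwise_insert
      using pairwise_subset[OF pw Diff_subset] non_overlapping_commute by blast
  next
    fix r
    have "{R \<in> merge Q A B. R \<inter> cball 0 r \<noteq> {}} \<subseteq> insert (A \<union> B) {R\<in>Q. R \<inter> cball 0 r \<noteq> {}}"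
      by (auto simp: merge_def)
    then show "finite {R \<in> merge Q A B. R \<inter> cball 0 r \<noteq> {}}"
      using T by (rule_tac finite_subset) (auto simp: tessellation_def)
  qed
  moreover have "\<exists>R\<in>merge Q A B. A' \<subseteq> R" if A': "A' \<in> P" for A'
  proof -
    obtain R where "R \<in> Q" "A' \<subseteq> R" using Q A' by (rule window_state_region)
    then show ?thesis by (cases "R \<in> {A, B}") (auto simp: merge_def)
  qed
  moreover have "\<exists>Y. Y \<subseteq> Union ` Pow W \<and> merge Q A B = (P - W) \<union> Y"
  proof -
    from Q obtain Y where Y: "Y \<subseteq> Union ` Pow W" "Q = (P - W) \<union> Y" by (auto simp: window_states_def)
    have n: "A \<notin> P - W" "B \<notin> P - W" using tessellation_subset_Union[OF P(1) _ P(2)] AB by blast+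
    then have "A \<in> Union ` Pow W" "B \<in> Union ` Pow W" using AB Y by auto
    then obtain F G where "F \<subseteq> W" "A = \<Union>F" "G \<subseteq> W" "B = \<Union>G" by auto
    then have "A \<union> B \<in> Union ` Pow W" by (intro image_eqI[of _ _ "F \<union> G"]) auto
    then show ?thesis using Y n by (intro exI[of _ "insert (A \<union> B) (Y - {A, B})"]) (auto simp: merge_def)
  qed
  ultimately show ?thesis by (simp add: window_states_def)
qed

text \<open>
  A discrete Gronwall inequality. The interval \<open>[0, t]\<close> is cut into steps of equal length \<open>h\<close>. The
  errors \<open>e * h * K\<close> add up to a multiple of \<open>e\<close>, independent of the number of steps, and \<open>e\<close> is
  arbitrary.
\<close>
lemma exp_bound_of_small_steps:
  fixes u :: "real \<Rightarrow> real"
  assumes step: "\<And>e. 0 < e \<Longrightarrow> \<exists>d>0. \<forall>s\<ge>0. \<forall>h. 0 < h \<and> h < d \<longrightarrow> u (s + h) \<le> (1 + a * h) * u s + e * h * K"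
    and nonneg: "\<And>s. 0 \<le> s \<Longrightarrow> 0 \<le> u s" and K: "0 \<le> K" and t: "0 \<le> t"
  shows "u t \<le> exp (a * t) * u 0"
proof (cases "t = 0")
  case False
  with t have t: "0 < t" by simp
  \<comment> \<open>The factor \<open>exp (\<bar>a\<bar> * t)\<close> covers the propagation of the errors for both signs of \<open>a\<close>.\<close>
  define c where "c = t * K * exp (\<bar>a\<bar> * t)"
  have "u t \<le> exp (a * t) * u 0 + e * c" if e: "0 < e" for e
  proof -
    obtain d where d: "0 < d" "\<And>s h. 0 \<le> s \<Longrightarrow> 0 < h \<Longrightarrow> h < d \<Longrightarrow> u (s + h) \<le> (1 + a * h) * u s + e * h * K"
      using step[OF e] by blast
    obtain m :: nat where m: "t / d < real m" using reals_Archimedean2 by blast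
    with d t have m0: "0 < m" by (cases m) (auto simp: divide_less_0_iff not_less[symmetric])
    define h where "h = t / real m"
    have h: "0 < h" "h < d" "real m * h = t" using m m0 t d by (auto simp: h_def field_simps)
    have "u (real k * h) \<le> exp (a * (real k * h)) * u 0 + e * K * (real k * h) * exp (\<bar>a\<bar> * (real k * h))" for k
    proof (induction k)
      case (Suc k)
      let ?s = "real k * h"
      have s: "real (Suc k) * h = ?s + h" by (simp add: algebra_simps)
      have s0: "0 \<le> ?s" using h by simp
      have "u (?s + h) \<le> (1 + a * h) * u ?s + e * h * K" by (rule d(2)[OF s0 h(1,2)])
      also have "\<dots> \<le> exp (a * h) * u ?s + e * h * K"
        using exp_ge_add_one_self[of "a * h"] nonneg[OF s0] by (intro add_right_mono mult_right_mono)
      also have "\<dots> \<le> exp (a * h) * (exp (a * ?s) * u 0 + e * K * ?s * exp (\<bar>a\<bar> * ?s)) + e * h * K"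
        using Suc.IH by simp
      also have "\<dots> = exp (a * (?s + h)) * u 0 + e * K * ?s * (exp (a * h) * exp (\<bar>a\<bar> * ?s)) + e * h * K * 1"
        by (simp add: algebra_simps exp_add)
      also have "\<dots> \<le> exp (a * (?s + h)) * u 0 + e * K * ?s * exp (\<bar>a\<bar> * (?s + h))
                        + e * h * K * exp (\<bar>a\<bar> * (?s + h))"
      proof (intro add_mono mult_left_mono order_refl)
        have "a * h \<le> \<bar>a\<bar> * h" using h by (intro mult_right_mono) auto
        then show "exp (a * h) * exp (\<bar>a\<bar> * ?s) \<le> exp (\<bar>a\<bar> * (?s + h))"
          by (simp add: algebra_simps flip: exp_add)
      qed (use e K s0 h in auto)
      also have "\<dots> = exp (a * (?s + h)) * u 0 + e * K * (?s + h) * exp (\<bar>a\<bar> * (?s + h))"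
        by (simp add: algebra_simps)
      finally show ?case unfolding s .
    qed simp
    from this[of m] show ?thesis unfolding h c_def by (simp add: algebra_simps)
  qed
  moreover have "0 \<le> c" using t K by (simp add: c_def)
  ultimately show ?thesis
  proof -
    assume b: "\<And>e. 0 < e \<Longrightarrow> u t \<le> exp (a * t) * u 0 + e * c" and c: "0 \<le> c"
    show ?thesis
    proof (rule field_le_epsilon)
      fix e :: real assume "0 < e"
      then have "u t \<le> exp (a * t) * u 0 + e / (c + 1) * c" using c by (intro b) simp
      also have "e / (c + 1) * c \<le> e" using \<open>0 < e\<close> c by (simp add: field_simps)
      finally show "u t \<le> exp (a * t) * u 0 + e" by simp
    qed
  qed
qed simp

locale window_chain = prob_space M
  for M :: "'w measure" +
  fixes rate :: "region \<Rightarrow> region \<Rightarrow> real" and P W :: config and Z :: "real \<Rightarrow> 'w \<Rightarrow> config"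
  assumes process: "window_process rate P W M Z"
    and tess: "tessellation P" and finW: "finite W" and WP: "W \<subseteq> P"
begin

abbreviation "states \<equiv> window_states P W"

definition state_prob :: "real \<Rightarrow> config \<Rightarrow> real" where
  "state_prob t Q = prob {\<omega>\<in>space M. Z t \<omega> = Q}"

definition transition_prob :: "real \<Rightarrow> real \<Rightarrow> config \<Rightarrow> config \<Rightarrow> real" where
  "transition_prob t h Q Q' = prob {\<omega>\<in>space M. Z t \<omega> = Q \<and> Z (t + h) \<omega> = Q'}"

lemma finite_states [simp]: "finite states"
  using finW by (rule finite_window_states)

lemma successors_subset: "Q \<in> states \<Longrightarrow> successors W Q \<subseteq> states"
  using merge_window_state[OF tess WP] by (auto simp: successors_def)

lemma finite_successors: "Q \<in> states \<Longrightarrow> finite (successors W Q)"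
  using successors_subset finite_states finite_subset by blast

lemma state_event [measurable]: "0 \<le> t \<Longrightarrow> {\<omega>\<in>space M. Z t \<omega> = Q} \<in> events"
  using process by (simp add: window_process_def)

lemma states_event:
  assumes "0 \<le> t" "finite \<Q>" shows "{\<omega>\<in>space M. Z t \<omega> \<in> \<Q>} \<in> events"
proof -
  have "{\<omega>\<in>space M. Z t \<omega> \<in> \<Q>} = (\<Union>Q\<in>\<Q>. {\<omega>\<in>space M. Z t \<omega> = Q})" by auto
  also have "\<dots> \<in> events" using assms by (intro sets.finite_UN state_event) auto
  finally show ?thesis .
qed

lemma not_states_event:
  assumes "0 \<le> t" "finite \<Q>" shows "{\<omega>\<in>space M. Z t \<omega> \<notin> \<Q>} \<in> events"
proof -
  have "{\<omega>\<in>space M. Z t \<omega> \<notin> \<Q>} = space M - {\<omega>\<in>space M. Z t \<omega> \<in> \<Q>}" by auto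
  then show ?thesis using states_event[OF assms] by auto
qed

lemma event_conj: "{\<omega>\<in>space M. p \<omega>} \<in> events \<Longrightarrow> {\<omega>\<in>space M. q \<omega>} \<in> events \<Longrightarrow>
    {\<omega>\<in>space M. p \<omega> \<and> q \<omega>} \<in> events"
  by (rule sets.sets_Collect_conj)

lemma state_prob_nonneg: "0 \<le> state_prob t Q"
  by (simp add: state_prob_def)

lemma state_prob_0: "state_prob 0 Q = (if Q = P then 1 else 0)"
proof -
  have "{\<omega>\<in>space M. Z 0 \<omega> = Q} = (if Q = P then space M else {})"
    using process by (auto simp: window_process_def)
  then show ?thesis by (simp add: state_prob_def prob_space)
qed

lemma sum_state_prob:
  assumes "0 \<le> t" "finite \<Q>" shows "(\<Sum>Q\<in>\<Q>. state_prob t Q) = prob {\<omega>\<in>space M. Z t \<omega> \<in> \<Q>}"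
proof -
  have "(\<Sum>Q\<in>\<Q>. state_prob t Q) = prob (\<Union>Q\<in>\<Q>. {\<omega>\<in>space M. Z t \<omega> = Q})"
    unfolding state_prob_def
    by (rule finite_measure_finite_Union[symmetric]) (use assms in \<open>auto simp: disjoint_family_on_def\<close>)
  also have "(\<Union>Q\<in>\<Q>. {\<omega>\<in>space M. Z t \<omega> = Q}) = {\<omega>\<in>space M. Z t \<omega> \<in> \<Q>}" by auto
  finally show ?thesis .
qed

lemma sum_transition_prob:
  assumes "0 \<le> t" "0 \<le> h" "finite \<Q>"
  shows "(\<Sum>Q'\<in>\<Q>. transition_prob t h Q Q') = prob {\<omega>\<in>space M. Z t \<omega> = Q \<and> Z (t + h) \<omega> \<in> \<Q>}"
proof -
  have "(\<Sum>Q'\<in>\<Q>. transition_prob t h Q Q') = prob (\<Union>Q'\<in>\<Q>. {\<omega>\<in>space M. Z t \<omega> = Q \<and> Z (t + h) \<omega> = Q'})"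
    unfolding transition_prob_def
    by (rule finite_measure_finite_Union[symmetric])
      (use assms in \<open>auto simp: disjoint_family_on_def intro!: event_conj state_event\<close>)
  also have "(\<Union>Q'\<in>\<Q>. {\<omega>\<in>space M. Z t \<omega> = Q \<and> Z (t + h) \<omega> = Q'})
      = {\<omega>\<in>space M. Z t \<omega> = Q \<and> Z (t + h) \<omega> \<in> \<Q>}" by auto
  finally show ?thesis .
qed

text \<open>
  The infinitesimal description conditioned on the present state, in the form in which it is summed
  over all states below.
\<close>
lemma infinitesimal:
  assumes "0 < e"
  obtains d where "0 < d"
    "\<And>t h Q A B. \<lbrakk>0 \<le> t; 0 < h; h < d; may_merge W Q A B\<rbrakk> \<Longrightarrow>
       \<bar>transition_prob t h Q (merge Q A B) - rate A B * h * state_prob t Q\<bar> \<le> e * h * state_prob t Q"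
    "\<And>t h Q. \<lbrakk>0 \<le> t; 0 < h; h < d\<rbrakk> \<Longrightarrow>
       prob {\<omega>\<in>space M. Z t \<omega> = Q \<and> Z (t + h) \<omega> \<notin> insert Q (successors W Q)} \<le> e * h * state_prob t Q"
proof -
  note window_process_def[THEN iffD1, OF process, THEN conjunct2, THEN conjunct2, THEN conjunct2,
      THEN spec, THEN mp, OF assms]
  then obtain d where d: "0 < d" and D: "\<forall>t\<ge>0. \<forall>h. 0 < h \<and> h < d \<longrightarrow>
       (\<forall>S z. finite S \<and> S \<subseteq> {0..t} \<and> t \<in> S \<longrightarrow>
         (let H = {\<omega>\<in>space M. \<forall>s\<in>S. Z s \<omega> = z s}; Q = z t in
           (\<forall>A B. may_merge W Q A B \<longrightarrow>
              \<bar>measure M {\<omega>\<in>H. Z (t + h) \<omega> = merge Q A B} - rate A B * h * measure M H\<bar>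
                \<le> e * h * measure M H) \<and>
           measure M {\<omega>\<in>H. Z (t + h) \<omega> \<notin> insert Q {merge Q A B |A B. may_merge W Q A B}}
             \<le> e * h * measure M H))"
    by (elim exE conjE) (rule that)
  have *: "(\<forall>A B. may_merge W Q A B \<longrightarrow>
       \<bar>transition_prob t h Q (merge Q A B) - rate A B * h * state_prob t Q\<bar> \<le> e * h * state_prob t Q) \<and>
     prob {\<omega>\<in>space M. Z t \<omega> = Q \<and> Z (t + h) \<omega> \<notin> insert Q (successors W Q)} \<le> e * h * state_prob t Q"
    if "0 \<le> t" "0 < h" "h < d" for t h Q
  proof -
    have H: "{\<omega>\<in>space M. \<forall>s\<in>{t}. Z s \<omega> = Q} = {\<omega>\<in>space M. Z t \<omega> = Q}" by simp
    have S: "{\<omega>\<in>{\<omega>\<in>space M. Z t \<omega> = Q}. q \<omega>} = {\<omega>\<in>space M. Z t \<omega> = Q \<and> q \<omega>}" for q by auto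
    have T: "finite {t} \<and> {t} \<subseteq> {0..t} \<and> t \<in> {t}" using that by simp
    show ?thesis
      using D[THEN spec, THEN mp, OF that(1), THEN spec, THEN mp, OF conjI[OF that(2,3)],
          THEN spec, of "{t}", THEN spec, of "\<lambda>_. Q",
          THEN mp, OF T]
      unfolding Let_def H S transition_prob_def state_prob_def successors_def .
  qed
  show ?thesis by (rule that[OF d]) (use * in blast)+
qed

text \<open>
  The description of the process does not exclude other values pointwise, but they have probability
  zero: each step leaves the set of states with probability at most \<open>e * h\<close>, and \<open>e\<close> is arbitrary.
\<close>
lemma outside_states_null:
  assumes "0 \<le> t" shows "prob {\<omega>\<in>space M. Z t \<omega> \<notin> states} = 0"
proof -
  define u where "u s = prob {\<omega>\<in>space M. Z s \<omega> \<notin> states}" for s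
  have "u t \<le> exp (0 * t) * u 0"
  proof (rule exp_bound_of_small_steps[where K = 1])
    fix e :: real assume "0 < e"
    obtain d where d: "0 < d" and D: "\<And>t h Q. \<lbrakk>0 \<le> t; 0 < h; h < d\<rbrakk> \<Longrightarrow>
       prob {\<omega>\<in>space M. Z t \<omega> = Q \<and> Z (t + h) \<omega> \<notin> insert Q (successors W Q)} \<le> e * h * state_prob t Q"
      by (rule infinitesimal[OF \<open>0 < e\<close>]) (rule that)
    have "u (s + h) \<le> u s + e * h" if s: "0 \<le> s" "0 < h" "h < d" for s h
    proof -
      define V where "V Q = {\<omega>\<in>space M. Z s \<omega> = Q \<and> Z (s + h) \<omega> \<notin> insert Q (successors W Q)}" for Q
      have VE: "V Q \<in> events" if "Q \<in> states" for Q
        unfolding V_def using s that finite_successors by (intro event_conj state_event not_states_event) auto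
      have "u (s + h) \<le> prob ({\<omega>\<in>space M. Z s \<omega> \<notin> states} \<union> (\<Union>Q\<in>states. V Q))"
        unfolding u_def
      proof (rule finite_measure_mono)
        show "{\<omega>\<in>space M. Z (s + h) \<omega> \<notin> states} \<subseteq> {\<omega>\<in>space M. Z s \<omega> \<notin> states} \<union> (\<Union>Q\<in>states. V Q)"
          using successors_subset by (fastforce simp: V_def)
      qed (use s VE in \<open>auto intro!: not_states_event sets.Un sets.finite_UN\<close>)
      also have "\<dots> \<le> u s + prob (\<Union>Q\<in>states. V Q)"
        unfolding u_def using s VE by (intro measure_Un_le not_states_event sets.finite_UN) auto
      also have "prob (\<Union>Q\<in>states. V Q) \<le> (\<Sum>Q\<in>states. prob (V Q))"
        using VE by (intro finite_measure_subadditive_finite) auto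
      also have "\<dots> \<le> (\<Sum>Q\<in>states. e * h * state_prob s Q)"
        unfolding V_def by (intro sum_mono D s)
      also have "\<dots> = e * h * prob {\<omega>\<in>space M. Z s \<omega> \<in> states}"
        using s sum_state_prob[of s states] by (simp flip: sum_distrib_left)
      also have "\<dots> \<le> e * h * 1" using s \<open>0 < e\<close> by (intro mult_left_mono) auto
      finally show ?thesis by simp
    qed
    with d show "\<exists>d>0. \<forall>s\<ge>0. \<forall>h. 0 < h \<and> h < d \<longrightarrow> u (s + h) \<le> (1 + 0 * h) * u s + e * h * 1" by auto
  qed (use assms in \<open>auto simp: u_def\<close>)
  moreover have "u 0 = 0"
  proof -
    have "{\<omega>\<in>space M. Z 0 \<omega> \<notin> states} = {}"
      using process initial_window_state[OF tess WP] by (auto simp: window_process_def)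
    then show ?thesis unfolding u_def by (simp only: measure_empty)
  qed
  ultimately show ?thesis using measure_nonneg[of M] by (simp add: u_def antisym)
qed

lemma AE_states: "0 \<le> t \<Longrightarrow> AE \<omega> in M. Z t \<omega> \<in> states"
  using outside_states_null[of t] not_states_event[of t states]
  by (subst AE_iff_measurable[OF _ refl]) (auto simp: emeasure_eq_measure)

lemma state_prob_step:
  assumes "0 \<le> t" "0 \<le> h" shows "state_prob (t + h) Q' = (\<Sum>Q\<in>states. transition_prob t h Q Q')"
proof -
  have "(\<Sum>Q\<in>states. transition_prob t h Q Q') = prob (\<Union>Q\<in>states. {\<omega>\<in>space M. Z t \<omega> = Q \<and> Z (t + h) \<omega> = Q'})"
    unfolding transition_prob_def
    by (rule finite_measure_finite_Union[symmetric])
      (use assms in \<open>auto simp: disjoint_family_on_def intro!: event_conj state_event\<close>)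
  also have "\<dots> = state_prob (t + h) Q'"
    unfolding state_prob_def
  proof (rule finite_measure_eq_AE)
    show "AE \<omega> in M. (\<omega> \<in> (\<Union>Q\<in>states. {\<omega>\<in>space M. Z t \<omega> = Q \<and> Z (t + h) \<omega> = Q'})) =
             (\<omega> \<in> {\<omega>\<in>space M. Z (t + h) \<omega> = Q'})"
      using AE_states[OF assms(1)] by eventually_elim auto
  qed (use assms in \<open>auto intro!: sets.finite_UN event_conj state_event\<close>)
  finally show ?thesis ..
qed

text \<open>
  If the generator maps \<open>f\<close> below \<open>a * f\<close>, then one small step multiplies the expectation of \<open>f\<close> by
  at most \<open>1 + a * h\<close>, up to \<open>o(h)\<close> uniformly in time. The growth of the perimeter and the decay of
  the probability of closed edges are both instances.
\<close>
lemma expectation_bound: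
  fixes f :: "config \<Rightarrow> real"
  assumes f: "\<And>Q. Q \<in> states \<Longrightarrow> 0 \<le> f Q"
    and drift: "\<And>Q. Q \<in> states \<Longrightarrow>
      (\<Sum>Q'\<in>successors W Q. jump_rate rate W Q Q' * (f Q' - f Q)) \<le> a * f Q"
    and t: "0 \<le> t"
  shows "(\<Sum>Q\<in>states. f Q * state_prob t Q) \<le> exp (a * t) * f P"
proof -
  define u where "u s = (\<Sum>Q\<in>states. f Q * state_prob s Q)" for s
  define F where "F = (\<Sum>Q\<in>states. f Q)"
  define N where "N = real (card states)"
  have fF: "f Q \<le> F" if "Q \<in> states" for Q
    unfolding F_def using f that by (intro member_le_sum) auto
  have F0: "0 \<le> F" unfolding F_def using f by (rule sum_nonneg)
  have diff: "\<bar>f Q' - f Q\<bar> \<le> F" if "Q \<in> states" "Q' \<in> states" for Q Q'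
    using fF[of Q] fF[of Q'] f[of Q] f[of Q'] that by (auto simp: abs_le_iff)
  have PS: "P \<in> states" by (rule initial_window_state[OF tess WP])
  have "u t \<le> exp (a * t) * u 0"
  proof (rule exp_bound_of_small_steps[where K = "(N + 1) * F"])
    fix e :: real assume e: "0 < e"
    obtain d where d: "0 < d"
      and D1: "\<And>t h Q A B. \<lbrakk>0 \<le> t; 0 < h; h < d; may_merge W Q A B\<rbrakk> \<Longrightarrow>
       \<bar>transition_prob t h Q (merge Q A B) - rate A B * h * state_prob t Q\<bar> \<le> e * h * state_prob t Q"
      and D2: "\<And>t h Q. \<lbrakk>0 \<le> t; 0 < h; h < d\<rbrakk> \<Longrightarrow>
       prob {\<omega>\<in>space M. Z t \<omega> = Q \<and> Z (t + h) \<omega> \<notin> insert Q (successors W Q)} \<le> e * h * state_prob t Q"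
      by (rule infinitesimal[OF e]) (rule that)
    have "u (s + h) \<le> (1 + a * h) * u s + e * h * ((N + 1) * F)" if s: "0 \<le> s" "0 < h" "h < d" for s h
    proof -
      have one: "(\<Sum>Q'\<in>states. f Q' * transition_prob s h Q Q') \<le> ((1 + a * h) * f Q + e * h * ((N + 1) * F)) * state_prob s Q"
        if Q: "Q \<in> states" for Q
      proof -
        let ?S = "successors W Q"
        let ?R = "states - insert Q ?S"
        have S: "?S \<subseteq> states" "finite ?S" using Q successors_subset finite_successors by auto
        have "(\<Sum>Q'\<in>states. f Q' * transition_prob s h Q Q') =
           f Q * (\<Sum>Q'\<in>states. transition_prob s h Q Q') + (\<Sum>Q'\<in>states. (f Q' - f Q) * transition_prob s h Q Q')"
          by (simp add: algebra_simps sum_subtractf sum_distrib_left)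
        also have "(\<Sum>Q'\<in>states. (f Q' - f Q) * transition_prob s h Q Q') =
            (\<Sum>Q'\<in>?S. (f Q' - f Q) * transition_prob s h Q Q') + (\<Sum>Q'\<in>?R. (f Q' - f Q) * transition_prob s h Q Q')"
        proof -
          have "(\<Sum>Q'\<in>states. (f Q' - f Q) * transition_prob s h Q Q') = (\<Sum>Q'\<in>?S \<union> ?R. (f Q' - f Q) * transition_prob s h Q Q')"
            by (rule sum.mono_neutral_right) (use S in auto)
          also have "\<dots> = (\<Sum>Q'\<in>?S. (f Q' - f Q) * transition_prob s h Q Q') + (\<Sum>Q'\<in>?R. (f Q' - f Q) * transition_prob s h Q Q')"
            by (rule sum.union_disjoint) (use S in auto)
          finally show ?thesis .
        qed
        also have "(\<Sum>Q'\<in>?R. (f Q' - f Q) * transition_prob s h Q Q') \<le> (\<Sum>Q'\<in>?R. F * transition_prob s h Q Q')"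
        proof (intro sum_mono mult_right_mono)
          fix Q' assume "Q' \<in> ?R" then show "f Q' - f Q \<le> F" using diff[OF Q, of Q'] by auto
        qed (simp add: transition_prob_def)
        also have "\<dots> = F * prob {\<omega>\<in>space M. Z s \<omega> = Q \<and> Z (s + h) \<omega> \<in> ?R}"
          using s by (simp add: sum_transition_prob flip: sum_distrib_left)
        also have "\<dots> \<le> F * prob {\<omega>\<in>space M. Z s \<omega> = Q \<and> Z (s + h) \<omega> \<notin> insert Q ?S}"
          using s S F0 by (intro mult_left_mono finite_measure_mono event_conj state_event not_states_event) auto
        also have "\<dots> \<le> F * (e * h * state_prob s Q)" by (intro mult_left_mono D2 s F0)
        also have "(\<Sum>Q'\<in>?S. (f Q' - f Q) * transition_prob s h Q Q') \<le>
            (\<Sum>Q'\<in>?S. (jump_rate rate W Q Q' * (f Q' - f Q)) * (h * state_prob s Q) + F * (e * h * state_prob s Q))"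
        proof (rule sum_mono)
          fix Q' assume Q': "Q' \<in> ?S"
          then obtain A B where AB: "merging_pair W Q Q' = (A, B)" "may_merge W Q A B" "Q' = merge Q A B"
            by (rule merging_pairE)
          have r: "jump_rate rate W Q Q' = rate A B" by (simp add: jump_rate_def AB(1))
          have "(f Q' - f Q) * (transition_prob s h Q Q' - rate A B * h * state_prob s Q) \<le>
             \<bar>f Q' - f Q\<bar> * \<bar>transition_prob s h Q Q' - rate A B * h * state_prob s Q\<bar>"
            by (metis abs_ge_self abs_mult)
          also have "\<dots> \<le> F * (e * h * state_prob s Q)"
            using D1[OF s AB(2)] diff[OF Q, of Q'] S Q' F0 by (intro mult_mono) (auto simp: AB(3))
          finally show "(f Q' - f Q) * transition_prob s h Q Q' \<le>
              (jump_rate rate W Q Q' * (f Q' - f Q)) * (h * state_prob s Q) + F * (e * h * state_prob s Q)"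
            by (simp add: r algebra_simps)
        qed
        also have "\<dots> = (\<Sum>Q'\<in>?S. jump_rate rate W Q Q' * (f Q' - f Q)) * (h * state_prob s Q)
                          + real (card ?S) * (F * (e * h * state_prob s Q))"
          by (simp add: sum.distrib sum_distrib_right)
        also have "\<dots> \<le> a * f Q * (h * state_prob s Q) + N * (F * (e * h * state_prob s Q))"
          unfolding N_def using drift[OF Q] s e F0 S
          by (intro add_mono mult_right_mono) (auto simp: state_prob_nonneg intro!: card_mono)
        also have "f Q * (\<Sum>Q'\<in>states. transition_prob s h Q Q') \<le> f Q * state_prob s Q"
        proof (intro mult_left_mono f Q)
          show "(\<Sum>Q'\<in>states. transition_prob s h Q Q') \<le> state_prob s Q"
            using s by (auto simp: sum_transition_prob state_prob_def intro!: finite_measure_mono state_event)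
        qed
        finally show ?thesis by (simp add: algebra_simps)
      qed
      have "u (s + h) = (\<Sum>Q\<in>states. \<Sum>Q'\<in>states. f Q' * transition_prob s h Q Q')"
        using s by (subst sum.swap) (simp add: u_def state_prob_step sum_distrib_left)
      also have "\<dots> \<le> (\<Sum>Q\<in>states. ((1 + a * h) * f Q + e * h * ((N + 1) * F)) * state_prob s Q)"
        by (intro sum_mono one)
      also have "\<dots> = (1 + a * h) * u s + e * h * ((N + 1) * F) * (\<Sum>Q\<in>states. state_prob s Q)"
        by (simp add: u_def distrib_right sum.distrib sum_distrib_left mult.assoc)
      also have "(\<Sum>Q\<in>states. state_prob s Q) \<le> 1" using s by (simp add: sum_state_prob)
      finally show ?thesis using e s F0 by (simp add: N_def mult_left_mono)
    qed
    with d show "\<exists>d>0. \<forall>s\<ge>0. \<forall>h. 0 < h \<and> h < d \<longrightarrow>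
        u (s + h) \<le> (1 + a * h) * u s + e * h * ((N + 1) * F)" by blast
  qed (use f t F0 in \<open>auto simp: u_def N_def state_prob_nonneg intro!: sum_nonneg\<close>)
  also have "u 0 = f P" unfolding u_def using PS by (simp add: state_prob_0 if_distrib sum.delta cong: if_cong)
  finally show ?thesis by (simp add: u_def)
qed

lemma markov_bound:
  fixes f :: "config \<Rightarrow> real"
  assumes f: "\<And>Q. Q \<in> states \<Longrightarrow> 0 \<le> f Q"
    and drift: "\<And>Q. Q \<in> states \<Longrightarrow>
      (\<Sum>Q'\<in>successors W Q. jump_rate rate W Q Q' * (f Q' - f Q)) \<le> a * f Q"
    and t: "0 \<le> t" and b: "0 < b"
  shows "prob {\<omega>\<in>space M. Z t \<omega> \<in> {Q\<in>states. b \<le> f Q}} \<le> exp (a * t) * f P / b"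
proof -
  have "b * prob {\<omega>\<in>space M. Z t \<omega> \<in> {Q\<in>states. b \<le> f Q}} = (\<Sum>Q\<in>{Q\<in>states. b \<le> f Q}. b * state_prob t Q)"
    using t by (subst sum_state_prob[symmetric]) (auto simp: sum_distrib_left)
  also have "\<dots> \<le> (\<Sum>Q\<in>{Q\<in>states. b \<le> f Q}. f Q * state_prob t Q)"
    by (intro sum_mono mult_right_mono) (auto simp: state_prob_nonneg)
  also have "\<dots> \<le> (\<Sum>Q\<in>states. f Q * state_prob t Q)"
    by (intro sum_mono2) (auto simp: state_prob_nonneg f)
  also have "\<dots> \<le> exp (a * t) * f P" by (rule expectation_bound[OF f drift t])
  finally show ?thesis using b by (simp add: field_simps)
qed

end

section \<open>Passing to the whole plane\<close>

context prob_space
begin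

text \<open>
  The limit inferior of events with probability at most \<open>\<epsilon>\<close> is an increasing union of events with
  probability at most \<open>\<epsilon>\<close>.
\<close>
lemma eventually_event_cover:
  assumes U: "\<And>n. n \<ge> N \<Longrightarrow> U n \<in> events \<and> prob (U n) \<le> \<epsilon>"
  obtains V where "V \<in> events" "prob V \<le> \<epsilon>" "\<And>\<omega>. \<forall>\<^sub>F n in sequentially. \<omega> \<in> U n \<Longrightarrow> \<omega> \<in> V"
proof
  define I where "I k = (\<Inter>n\<in>{N + k..}. U n)" for k
  have I: "I k \<in> events" for k
    unfolding I_def using U by (intro sets.countable_INT') auto
  show "(\<Union>k. I k) \<in> events" using I by auto
  have "(\<lambda>k. prob (I k)) \<longlonglongrightarrow> prob (\<Union>k. I k)"
    by (rule finite_Lim_measure_incseq) (use I in \<open>auto simp: incseq_def I_def\<close>)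
  moreover have "prob (I k) \<le> \<epsilon>" for k
  proof -
    have "prob (I k) \<le> prob (U (N + k))"
      using U[of "N + k"] by (intro finite_measure_mono) (auto simp: I_def)
    then show ?thesis using U[of "N + k"] by simp
  qed
  ultimately show "prob (\<Union>k. I k) \<le> \<epsilon>" by (intro LIMSEQ_le_const2) auto
  show "\<omega> \<in> (\<Union>k. I k)" if ev: "\<forall>\<^sub>F n in sequentially. \<omega> \<in> U n" for \<omega>
  proof -
    obtain k where "\<And>n. n \<ge> k \<Longrightarrow> \<omega> \<in> U n" using ev by (auto simp: eventually_sequentially)
    then have "\<omega> \<in> I k" by (auto simp: I_def)
    then show ?thesis by blast
  qed
qed

text \<open>
  The exceptional sets considered here need not be measurable, so they are covered by measurable sets
  of small probability.
\<close>
lemma AE_not_if_small_cover: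
  assumes "\<And>\<epsilon>. 0 < \<epsilon> \<Longrightarrow> \<exists>V\<in>events. prob V \<le> \<epsilon> \<and> (AE \<omega> in M. bad \<omega> \<longrightarrow> \<omega> \<in> V)"
  shows "AE \<omega> in M. \<not> bad \<omega>"
proof -
  have "\<forall>k. \<exists>V. V \<in> events \<and> prob V \<le> inverse (real (Suc k)) \<and> (AE \<omega> in M. bad \<omega> \<longrightarrow> \<omega> \<in> V)"
    using assms[of "inverse (real (Suc _))"] by (simp add: Bex_def)
  then obtain V where V: "\<And>k. V k \<in> events" "\<And>k. prob (V k) \<le> inverse (real (Suc k))"
    "\<And>k. AE \<omega> in M. bad \<omega> \<longrightarrow> \<omega> \<in> V k" by metis
  define N where "N = (\<Inter>k. V k)"
  have N: "N \<in> events" unfolding N_def using V(1) by auto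
  have "prob N \<le> inverse (real (Suc k))" for k
    using V(1) by (intro order_trans[OF finite_measure_mono V(2)]) (auto simp: N_def)
  then have "prob N \<le> 0" by (intro LIMSEQ_le_const[OF LIMSEQ_inverse_real_of_nat]) auto
  then have "emeasure M N = 0" using measure_nonneg[of M N] by (simp add: emeasure_eq_measure antisym)
  then have "AE \<omega> in M. \<omega> \<notin> N" using N by (intro AE_not_in) auto
  moreover have "AE \<omega> in M. \<forall>k. bad \<omega> \<longrightarrow> \<omega> \<in> V k"
    by (rule AE_all_countable[THEN iffD2]) (use V(3) in blast)
  ultimately show ?thesis by eventually_elim (auto simp: N_def)
qed

end

lemma empire_process_windows:
  assumes X: "empire_process rate P M X" and P: "tessellation P"
  obtains r Z where "filterlim r at_top sequentially"
    "\<And>n :: nat. window_chain M rate P {A\<in>P. A \<subseteq> cball 0 (r n)} (Z n)"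
    "\<And>t. 0 \<le> t \<Longrightarrow> AE \<omega> in M. \<forall>A\<in>P. \<forall>B\<in>P. \<forall>\<^sub>F n in sequentially.
           in_same_region (Z n t \<omega>) A B = in_same_region (X t \<omega>) A B"
proof -
  obtain r :: "nat \<Rightarrow> real" and Z where r: "filterlim r at_top sequentially"
    and Z: "\<forall>n. window_process rate P {A\<in>P. A \<subseteq> cball 0 (r n)} M (Z n)"
    and lim: "\<forall>t\<ge>0. AE \<omega> in M. \<forall>A\<in>P. \<forall>B\<in>P. \<forall>\<^sub>F n in sequentially.
          in_same_region (Z n t \<omega>) A B = in_same_region (X t \<omega>) A B"
    using X unfolding empire_process_def by (elim conjE exE) (rule that)
  have "window_chain M rate P {A\<in>P. A \<subseteq> cball 0 (r n)} (Z n)" for n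
    using X Z P tessellation_finite_bounded[OF P]
    by (auto simp: window_chain_def window_chain_axioms_def empire_process_def)
  with r lim show ?thesis by (intro that[of r Z]) auto
qed

lemma empire_region_blocks:
  assumes X: "empire_process rate P M X" and \<omega>: "\<omega> \<in> space M" "0 \<le> t" and R: "R \<in> X t \<omega>"
  obtains b where "b \<subseteq> P" "b \<noteq> {}" "R = \<Union>b"
proof -
  have "\<exists>C. partition_on P C \<and> X t \<omega> = Union ` C"
    using X \<omega> unfolding empire_process_def by blast
  then obtain C where C: "partition_on P C" "X t \<omega> = Union ` C" by blast
  then obtain b where "b \<in> C" "R = \<Union>b" using R by auto
  moreover from this have "b \<subseteq> P" "b \<noteq> {}" using C(1) by (auto simp: partition_on_def)
  ultimately show ?thesis using that by blast
qed

lemma area_mono_cells: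
  assumes P: "tessellation P" and b: "b \<subseteq> P" and A: "A \<subseteq> \<Union>b"
  shows "area A \<le> area (\<Union>b)"
proof -
  have "\<Union>b \<in> sets borel"
  proof (rule sets.countable_Union)
    show "countable b" using tessellation_countable[OF P] b by (rule countable_subset[rotated])
    show "b \<subseteq> sets borel" using P b by (auto simp: tessellation_def intro!: borel_closed polygonal_closed)
  qed
  then show ?thesis unfolding area_def using A by (intro emeasure_mono) auto
qed

section \<open>Growth of the perimeter\<close>

definition empire_of :: "region \<Rightarrow> config \<Rightarrow> region" where
  "empire_of A Q = (THE R. R \<in> Q \<and> A \<subseteq> R)"

lemma empire_of_eq:
  assumes "tessellation Q" "polygonal A" "R \<in> Q" "A \<subseteq> R" shows "empire_of A Q = R"
  unfolding empire_of_def
  by (rule the_equality) (use assms tessellation_subset_eqI in blast)+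

lemma merge_commute: "merge Q A B = merge Q B A"
  by (auto simp: merge_def)

text \<open>
  Only mergers of the region \<open>A\<close> containing \<open>A0\<close> change \<open>\<phi>\<close>, and a merger with the neighbour \<open>B\<close>
  raises it by at most \<open>peri B\<close>. Different targets belong to different neighbours, so the sum over
  targets is bounded by the sum over neighbours in the assumption.
\<close>
lemma perimeter_drift:
  assumes mr: "merger_rate rate" and P: "tessellation P" "W \<subseteq> P" "finite W"
    and bnd: "\<And>P A. tessellation P \<Longrightarrow> A \<in> P \<Longrightarrow>
              (\<Sum>B\<in>neighbours P A. ennreal (rate A B) * peri B) \<le> ennreal C * peri A"
    and A0: "A0 \<in> P" and Q: "Q \<in> window_states P W"
  defines "\<phi> \<equiv> \<lambda>Q. enn2real (peri (empire_of A0 Q))"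
  shows "(\<Sum>Q'\<in>successors W Q. jump_rate rate W Q Q' * (\<phi> Q' - \<phi> Q)) \<le> max C 0 * \<phi> Q"
proof -
  have T: "tessellation Q" using Q by (rule window_state_tessellation)
  have poly: "polygonal R" if "R \<in> Q" for R using T that by (simp add: tessellation_def)
  have A0p: "polygonal A0" using P A0 by (simp add: tessellation_def)
  obtain A where A: "A \<in> Q" "A0 \<subseteq> A" using Q A0 by (rule window_state_region)
  have eA: "empire_of A0 Q = A" using T A0p A by (rule empire_of_eq)
  define p where "p R = enn2real (peri R)" for R
  have fin: "ennreal (p R) = peri R" if "R \<in> Q" for R
    using peri_finite[OF poly[OF that]] by (simp add: p_def)
  define nb where "nb = neighbours Q A"
  have nbQ: "B \<in> Q" if "B \<in> nb" for B using that by (simp add: nb_def neighbours_def)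
  have rate: "rate A1 B1 = rate B1 A1 \<and> 0 < rate A1 B1"
    if "A1 \<in> Q" "B1 \<in> Q" "A1 \<noteq> B1" "common_length A1 B1 > 0" for A1 B1
  proof -
    have "non_overlapping A1 B1" using T that by (auto simp: tessellation_def pairwise_def)
    then show ?thesis using mr that poly unfolding merger_rate_def by blast
  qed
  have rate_nb: "0 < rate A B" if "B \<in> nb" for B
    using rate[of A B] that A by (auto simp: nb_def neighbours_def)
  have total: "(\<Sum>B\<in>nb. rate A B * p B) \<le> max C 0 * p A"
  proof -
    have "ennreal (\<Sum>B\<in>nb. rate A B * p B) = (\<Sum>B\<in>nb. ennreal (rate A B * p B))"
      using rate_nb by (intro sum_ennreal[symmetric]) (auto simp: p_def less_imp_le)
    also have "\<dots> = (\<Sum>B\<in>nb. ennreal (rate A B) * peri B)"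
      by (intro sum.cong refl) (simp add: ennreal_mult' rate_nb less_imp_le p_def[symmetric] fin nbQ flip: fin)
    also have "\<dots> \<le> ennreal C * peri A" unfolding nb_def by (rule bnd[OF T A(1)])
    also have "\<dots> = ennreal (max C 0) * ennreal (p A)" using fin[OF A(1)] by (simp add: max_def ennreal_neg)
    also have "\<dots> = ennreal (max C 0 * p A)" by (simp add: ennreal_mult p_def)
    finally show ?thesis by (simp add: p_def ennreal_le_iff)
  qed
  define S where "S = successors W Q"
  \<comment> \<open>The targets of mergers of \<open>A\<close>, whichever component of the representative pair is \<open>A\<close>.\<close>
  define S' where "S' = {Q'\<in>S. \<exists>B\<in>nb. Q' = merge Q A B \<and> jump_rate rate W Q Q' = rate A B}"
  have SQ: "S \<subseteq> window_states P W"
    using merge_window_state[OF P(1,2) Q] by (auto simp: S_def successors_def)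
  then have finS: "finite S" using finite_window_states[OF P(3)] by (rule finite_subset)
  have "\<forall>Q'\<in>S'. \<exists>B. B \<in> nb \<and> Q' = merge Q A B \<and> jump_rate rate W Q Q' = rate A B"
    by (auto simp: S'_def)
  then obtain other where other: "\<And>Q'. Q' \<in> S' \<Longrightarrow> other Q' \<in> nb"
      "\<And>Q'. Q' \<in> S' \<Longrightarrow> Q' = merge Q A (other Q')"
      "\<And>Q'. Q' \<in> S' \<Longrightarrow> jump_rate rate W Q Q' = rate A (other Q')" by metis
  have in_S': "\<phi> Q' - \<phi> Q \<le> p (other Q')" if Q': "Q' \<in> S'" for Q'
  proof -
    let ?B = "other Q'"
    have "tessellation Q'" using Q' SQ window_state_tessellation by (auto simp: S'_def)
    moreover have "A \<union> ?B \<in> Q'"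
      using other(2)[OF Q'] by (metis insertI1 merge_def)
    ultimately have "empire_of A0 Q' = A \<union> ?B" using A0p A by (intro empire_of_eq) auto
    then have "ennreal (\<phi> Q') = ennreal (enn2real (peri (A \<union> ?B)))" by (simp add: \<phi>_def)
    also have "\<dots> \<le> peri (A \<union> ?B)" by (simp add: ennreal_enn2real_if)
    also have "\<dots> \<le> peri A + peri ?B" by (rule peri_Un)
    also have "\<dots> = ennreal (p A + p ?B)"
      using fin[OF A(1)] fin[OF nbQ[OF other(1)[OF Q']]] by (simp add: p_def)
    finally have "\<phi> Q' \<le> p A + p ?B" by (subst (asm) ennreal_le_iff) (auto simp: p_def)
    then show ?thesis by (simp add: \<phi>_def eA p_def)
  qed
  have not_in_S': "\<phi> Q' = \<phi> Q" if Q': "Q' \<in> S - S'" for Q'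
  proof -
    have "Q' \<in> successors W Q" using Q' by (simp add: S_def)
    then obtain A1 B1 where AB: "merging_pair W Q Q' = (A1, B1)" "may_merge W Q A1 B1" "Q' = merge Q A1 B1"
      by (rule merging_pairE)
    have m: "A1 \<in> Q" "B1 \<in> Q" "A1 \<noteq> B1" "common_length A1 B1 > 0"
      using AB(2) by (auto simp: may_merge_def neighbours_def)
    have jr: "jump_rate rate W Q Q' = rate A1 B1" by (simp add: jump_rate_def AB(1))
    have "A \<noteq> A1"
    proof
      assume "A = A1"
      then have "B1 \<in> nb" using m by (auto simp: nb_def neighbours_def)
      then have "Q' \<in> S'" using \<open>A = A1\<close> AB jr Q' by (auto simp: S'_def)
      with Q' show False by simp
    qed
    moreover have "A \<noteq> B1"
    proof
      assume "A = B1"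
      then have "A1 \<in> nb" using m by (auto simp: nb_def neighbours_def common_length_commute)
      moreover have "rate A1 B1 = rate B1 A1" using rate[OF m] by simp
      ultimately have "Q' \<in> S'" using \<open>A = B1\<close> AB jr Q' merge_commute by (auto simp: S'_def)
      with Q' show False by simp
    qed
    ultimately have "A \<in> Q'" using A AB(3) by (simp add: merge_def)
    moreover have "tessellation Q'"
      using AB merge_window_state[OF P(1,2) Q] by (auto intro: window_state_tessellation)
    ultimately have "empire_of A0 Q' = A" using A0p A by (intro empire_of_eq) auto
    then show ?thesis by (simp add: \<phi>_def eA)
  qed
  have "(\<Sum>Q'\<in>S. jump_rate rate W Q Q' * (\<phi> Q' - \<phi> Q)) = (\<Sum>Q'\<in>S'. jump_rate rate W Q Q' * (\<phi> Q' - \<phi> Q))"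
    using finS not_in_S' by (intro sum.mono_neutral_right) (auto simp: S'_def)
  also have "\<dots> \<le> (\<Sum>Q'\<in>S'. rate A (other Q') * p (other Q'))"
  proof (rule sum_mono)
    fix Q' assume "Q' \<in> S'"
    then show "jump_rate rate W Q Q' * (\<phi> Q' - \<phi> Q) \<le> rate A (other Q') * p (other Q')"
      using in_S' other rate_nb by (auto intro!: mult_left_mono less_imp_le)
  qed
  also have "\<dots> = (\<Sum>B\<in>other ` S'. rate A B * p B)"
  proof -
    have "inj_on other S'" by (rule inj_onI) (metis other(2))
    then show ?thesis by (simp add: sum.reindex)
  qed
  also have "\<dots> \<le> (\<Sum>B\<in>nb. rate A B * p B)"
    using other(1) rate_nb finite_neighbours[OF T A(1)]
    by (intro sum_mono2) (auto simp: nb_def p_def less_imp_le)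
  also have "\<dots> \<le> max C 0 * p A" by (rule total)
  finally show ?thesis by (simp add: S_def \<phi>_def eA p_def)
qed

lemma far_points_long_perimeter:
  fixes R :: region
  assumes R: "connected R" "bounded R" and x: "x \<in> R" "norm x \<le> \<rho>" and y: "y \<in> R" "2 * (b + \<rho>) \<le> norm y"
  shows "ennreal b \<le> peri R"
proof -
  have "norm y \<le> \<bar>y $ 1\<bar> + \<bar>y $ 2\<bar>" using norm_le_l1_cart[of y] by (simp add: sum_2)
  moreover have "s \<le> u \<or> s \<le> w" if "n \<le> u + w" "2 * s \<le> n" for n s u w :: real using that by linarith
  ultimately have "b + \<rho> \<le> \<bar>y $ 1\<bar> \<or> b + \<rho> \<le> \<bar>y $ 2\<bar>" using y(2) by blast
  then obtain i where i: "b + \<rho> \<le> \<bar>y $ i\<bar>" by blast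
  have "\<bar>x $ i\<bar> \<le> \<rho>" using component_le_norm_cart[of x i] x(2) by simp
  with i have "b \<le> y $ i - x $ i \<or> b \<le> x $ i - y $ i" by linarith
  then show ?thesis
    using width_le_peri[OF R x(1) y(1), of i] width_le_peri[OF R y(1) x(1), of i]
    by (meson ennreal_leI order_trans)
qed

text \<open>
  If the region of \<open>A0\<close> is unbounded, then in all large windows the region of \<open>A0\<close> has perimeter at
  least \<open>b\<close>, for every \<open>b\<close>. In each window this has probability at most \<open>exp (a * t) * peri A0 / b\<close>
  with \<open>a = max C 0\<close>.
\<close>
lemma cell_in_bounded_region:
  fixes M :: "'w measure"
  assumes mr: "merger_rate rate" and X: "empire_process rate P M X" and P: "tessellation P"
    and bnd: "\<And>P A. tessellation P \<Longrightarrow> A \<in> P \<Longrightarrow>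
              (\<Sum>B\<in>neighbours P A. ennreal (rate A B) * peri B) \<le> ennreal C * peri A"
    and A0: "A0 \<in> P" and t: "0 \<le> t"
  shows "AE \<omega> in M. \<exists>D. \<forall>B\<in>P. in_same_region (X t \<omega>) A0 B \<longrightarrow> B \<subseteq> cball 0 D"
proof -
  interpret prob_space M using X by (simp add: empire_process_def)
  obtain r Z where Z: "\<And>n :: nat. window_chain M rate P {A\<in>P. A \<subseteq> cball 0 (r n)} (Z n)"
    and lim: "\<And>t. 0 \<le> t \<Longrightarrow> AE \<omega> in M. \<forall>A\<in>P. \<forall>B\<in>P. \<forall>\<^sub>F n in sequentially.
           in_same_region (Z n t \<omega>) A B = in_same_region (X t \<omega>) A B"
    by (rule empire_process_windows[OF X P]) (rule that)
  define W where "W n = {A\<in>P. A \<subseteq> cball 0 (r n)}" for n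
  define \<phi> where "\<phi> Q = enn2real (peri (empire_of A0 Q))" for Q
  define a where "a = max C 0"
  have A0p: "polygonal A0" using P A0 by (simp add: tessellation_def)
  obtain x where x: "x \<in> A0" using polygonal_nonempty[OF A0p] by blast
  define bad where "bad \<omega> \<longleftrightarrow> (\<forall>D. \<exists>B\<in>P. in_same_region (X t \<omega>) A0 B \<and> \<not> B \<subseteq> cball 0 D)" for \<omega>
  have "AE \<omega> in M. \<not> bad \<omega>"
  proof (rule AE_not_if_small_cover)
    fix \<epsilon> :: real assume \<epsilon>: "0 < \<epsilon>"
    \<comment> \<open>Markov's inequality at level \<open>b\<close> gives probability at most \<open>\<epsilon>\<close>; the summand 1 keeps \<open>b\<close> positive.\<close>
    define b where "b = exp (a * t) * \<phi> P / \<epsilon> + 1"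
    have \<phi>0: "0 \<le> \<phi> Q" for Q by (simp add: \<phi>_def)
    have b: "0 < b" using \<epsilon> \<phi>0[of P] by (simp add: b_def add_nonneg_pos)
    define G where "G n = {Q\<in>window_states P (W n). b \<le> \<phi> Q}" for n
    define U where "U n = {\<omega>\<in>space M. Z n t \<omega> \<in> G n}" for n
    have "U n \<in> events \<and> prob (U n) \<le> \<epsilon>" for n
    proof
      interpret window_chain M rate P "W n" "Z n" using Z by (simp add: W_def)
      show "U n \<in> events"
        unfolding U_def using t finite_states by (intro states_event) (auto simp: G_def)
      have "prob (U n) \<le> exp (a * t) * \<phi> P / b"
        unfolding U_def G_def
      proof (rule markov_bound)
        fix Q assume Q: "Q \<in> states"
        show "(\<Sum>Q'\<in>successors (W n) Q. jump_rate rate (W n) Q Q' * (\<phi> Q' - \<phi> Q)) \<le> a * \<phi> Q"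
          unfolding \<phi>_def a_def by (rule perimeter_drift[OF mr tess WP finW bnd A0 Q])
      qed (use \<phi>0 t b in auto)
      also have "\<dots> \<le> \<epsilon>" using b \<epsilon> by (simp add: b_def field_simps)
      finally show "prob (U n) \<le> \<epsilon>" .
    qed
    then obtain V where V: "V \<in> events" "prob V \<le> \<epsilon>" "\<And>\<omega>. \<forall>\<^sub>F n in sequentially. \<omega> \<in> U n \<Longrightarrow> \<omega> \<in> V"
      using eventually_event_cover[of 0 U \<epsilon>] by blast
    have st: "AE \<omega> in M. Z n t \<omega> \<in> window_states P (W n)" for n
    proof -
      interpret window_chain M rate P "W n" "Z n" using Z by (simp add: W_def)
      show ?thesis using t by (rule AE_states)
    qed
    then have "AE \<omega> in M. \<forall>n. Z n t \<omega> \<in> window_states P (W n)" by (simp add: AE_all_countable)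
    with lim[OF t] AE_space have "AE \<omega> in M. bad \<omega> \<longrightarrow> \<omega> \<in> V"
    proof eventually_elim
      case (elim \<omega>)
      show ?case
      proof
        assume "bad \<omega>"
        \<comment> \<open>Some coordinate of a point outside this ball differs by at least \<open>b\<close> from that of \<open>x\<close>.\<close>
        then obtain B where B: "B \<in> P" "in_same_region (X t \<omega>) A0 B" "\<not> B \<subseteq> cball 0 (2 * (b + norm x))"
          unfolding bad_def by blast
        then obtain y where y: "y \<in> B" "2 * (b + norm x) \<le> norm y" by force
        have "\<forall>\<^sub>F n in sequentially. in_same_region (Z n t \<omega>) A0 B"
          using elim(1) A0 B(1,2) by fastforce
        then have "\<forall>\<^sub>F n in sequentially. \<omega> \<in> U n"
        proof eventually_elim
          fix n assume "in_same_region (Z n t \<omega>) A0 B"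
          then obtain R where R: "R \<in> Z n t \<omega>" "A0 \<subseteq> R" "B \<subseteq> R" by (auto simp: in_same_region_def)
          have s: "Z n t \<omega> \<in> window_states P (W n)" using elim(3) by simp
          then have T: "tessellation (Z n t \<omega>)" by (rule window_state_tessellation)
          then have Rp: "polygonal R" using R(1) by (simp add: tessellation_def)
          have "ennreal b \<le> peri R"
            using Rp R x y
            by (intro far_points_long_perimeter[of R x "norm x" y])
              (auto simp: polygonal_def compact_imp_bounded intro!: compact_imp_bounded[OF polygonal_compact[OF Rp]])
          also have "peri R = ennreal (\<phi> (Z n t \<omega>))"
            using peri_finite[OF Rp] by (simp add: \<phi>_def empire_of_eq[OF T A0p R(1,2)])
          finally have "b \<le> \<phi> (Z n t \<omega>)" using \<phi>0 by (simp add: ennreal_le_iff)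
          then show "\<omega> \<in> U n" using s elim(2) by (simp add: U_def G_def)
        qed
        then show "\<omega> \<in> V" by (rule V(3))
      qed
    qed
    with V(1,2) show "\<exists>V\<in>events. prob V \<le> \<epsilon> \<and> (AE \<omega> in M. bad \<omega> \<longrightarrow> \<omega> \<in> V)" by blast
  qed
  then show ?thesis by eventually_elim (auto simp: bad_def)
qed

theorem no_infinite_region:
  fixes M :: "'w measure"
  assumes mr: "merger_rate rate" and X: "empire_process rate P M X" and P: "tessellation P"
    and bnd: "\<And>P A. tessellation P \<Longrightarrow> A \<in> P \<Longrightarrow>
              (\<Sum>B\<in>neighbours P A. ennreal (rate A B) * peri B) \<le> ennreal C * peri A"
  shows "AE \<omega> in M. \<not> infinite_region_appears X \<omega>"
proof -
  have "AE \<omega> in M. \<forall>A\<in>P. \<exists>D. \<forall>B\<in>P. in_same_region (X (real k) \<omega>) A B \<longrightarrow> B \<subseteq> cball 0 D" for k :: nat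
    using tessellation_countable[OF P] cell_in_bounded_region[OF mr X P bnd]
    by (subst AE_ball_countable) auto
  then have "AE \<omega> in M. \<forall>k::nat. \<forall>A\<in>P. \<exists>D. \<forall>B\<in>P.
      in_same_region (X (real k) \<omega>) A B \<longrightarrow> B \<subseteq> cball 0 D"
    by (simp add: AE_all_countable)
  with AE_space show ?thesis
  proof eventually_elim
    case (elim \<omega>)
    show ?case
    proof
      assume "infinite_region_appears X \<omega>"
      then obtain t R where t: "0 \<le> t" and R: "R \<in> X t \<omega>" "area R = \<infinity>"
        by (auto simp: infinite_region_appears_def)
      obtain k :: nat where k: "t \<le> real k" using real_arch_simple by blast
      have "\<forall>s\<ge>0. \<forall>t\<ge>s. \<forall>R\<in>X s \<omega>. \<exists>R'\<in>X t \<omega>. R \<subseteq> R'"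
        using X elim(1) unfolding empire_process_def by blast
      then obtain R' where R': "R' \<in> X (real k) \<omega>" "R \<subseteq> R'" using t k R(1) by blast
      obtain b where b: "b \<subseteq> P" "b \<noteq> {}" "R' = \<Union>b"
        by (rule empire_region_blocks[OF X elim(1) of_nat_0_le_iff R'(1)])
      then obtain A where A: "A \<in> b" "A \<in> P" by blast
      have "\<exists>D. \<forall>B\<in>P. in_same_region (X (real k) \<omega>) A B \<longrightarrow> B \<subseteq> cball 0 D"
        using elim(2) A(2) by simp
      then obtain D where D: "\<forall>B\<in>P. in_same_region (X (real k) \<omega>) A B \<longrightarrow> B \<subseteq> cball 0 D" ..
      have "R' \<subseteq> cball 0 D"
        unfolding b(3)
      proof (rule Union_least)
        fix B assume B: "B \<in> b"
        then have "in_same_region (X (real k) \<omega>) A B"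
          using R'(1) A b(3) by (auto simp: in_same_region_def intro!: bexI[of _ R'])
        then show "B \<subseteq> cball 0 D" using D B b(1) by (meson subsetD)
      qed
      then have "area R' \<le> emeasure lborel (cball (0 :: plane) D)"
        unfolding area_def by (rule emeasure_mono) simp
      also have "\<dots> < \<infinity>" by (rule emeasure_bounded_finite) simp
      finally have "area R' < \<infinity>" .
      moreover have "area R \<le> area R'" using area_mono_cells[OF P b(1)] R'(2) b(3) by simp
      ultimately show False using R(2) by simp
    qed
  qed
qed

section \<open>Lattice paths around a finite set of sites\<close>

type_synonym site = "int \<times> int"
text \<open>
  An edge is given by its left or lower end and a direction: \<open>True\<close> for horizontal, \<open>False\<close> for
  vertical.
\<close>
type_synonym edge = "site \<times> bool"

fun far_end :: "edge \<Rightarrow> site" where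
  "far_end ((x, y), True) = (x + 1, y)"
| "far_end ((x, y), False) = (x, y + 1)"

definition edge_boundary :: "site set \<Rightarrow> edge set" where
  "edge_boundary F = {e. (fst e \<in> F) \<noteq> (far_end e \<in> F)}"

fun face_edges :: "site \<Rightarrow> edge set" where
  "face_edges (x, y) = {((x, y), True), ((x, y + 1), True), ((x, y), False), ((x + 1, y), False)}"

definition cofacial :: "edge \<Rightarrow> edge \<Rightarrow> bool" where
  "cofacial e e' \<longleftrightarrow> (\<exists>f. e \<in> face_edges f \<and> e' \<in> face_edges f)"

text \<open>
  An edge lies on two faces, each with four edges. Counting the edge itself does no harm.
\<close>
fun edge_nbrs :: "edge \<Rightarrow> edge set" where
  "edge_nbrs ((x, y), True) = face_edges (x, y) \<union> face_edges (x, y - 1)"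
| "edge_nbrs ((x, y), False) = face_edges (x, y) \<union> face_edges (x - 1, y)"

lemma cofacial_edge_nbrs: "cofacial e e' \<Longrightarrow> e' \<in> edge_nbrs e"
  by (auto simp: cofacial_def)

lemma card_face_edges: "card (face_edges f) \<le> 4"
  by (cases f) (auto intro: order_trans[OF card_insert_le_m1])

lemma finite_edge_nbrs: "finite (edge_nbrs e)"
  by (cases e rule: edge_nbrs.cases) auto

lemma card_edge_nbrs: "card (edge_nbrs e) \<le> 8"
  by (cases e rule: edge_nbrs.cases)
    (auto simp del: face_edges.simps intro!: order_trans[OF card_Un_le]
      order_trans[OF add_mono[OF card_face_edges card_face_edges]])

fun edge_paths :: "edge \<Rightarrow> nat \<Rightarrow> edge list set" where
  "edge_paths e 0 = {[e]}"
| "edge_paths e (Suc n) = (\<Union>e'\<in>edge_nbrs e. (#) e ` edge_paths e' n)"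

lemma finite_edge_paths: "finite (edge_paths e n)"
  by (induction n arbitrary: e) (auto simp: finite_edge_nbrs)

lemma card_edge_paths: "card (edge_paths e n) \<le> 8 ^ n"
proof (induction n arbitrary: e)
  case (Suc n)
  have "card (edge_paths e (Suc n)) \<le> (\<Sum>e'\<in>edge_nbrs e. card ((#) e ` edge_paths e' n))"
    by (simp add: card_UN_le finite_edge_nbrs)
  also have "\<dots> \<le> (\<Sum>e'\<in>edge_nbrs e. 8 ^ n)"
    by (intro sum_mono order_trans[OF card_image_le] finite_edge_paths Suc.IH)
  also have "\<dots> \<le> 8 ^ Suc n" using card_edge_nbrs[of e] by simp
  finally show ?case .
qed simp

lemma length_edge_paths: "es \<in> edge_paths e n \<Longrightarrow> length es = Suc n"
  by (induction n arbitrary: e es) auto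

lemma rtrancl_path_edge_paths:
  assumes "rtrancl_path r e es e'" "\<And>e e'. r e e' \<Longrightarrow> cofacial e e'" "n \<le> length es"
  shows "e # take n es \<in> edge_paths e n"
  using assms
proof (induction arbitrary: n rule: rtrancl_path.induct)
  case (step e e' es e'')
  show ?case
  proof (cases n)
    case (Suc m)
    then have "e' # take m es \<in> edge_paths e' m" using step by simp
    moreover have "e' \<in> edge_nbrs e" using step by (blast intro: cofacial_edge_nbrs)
    ultimately show ?thesis using Suc by auto
  qed simp
qed simp

text \<open>
  Each step moves the horizontal position by at most one, so a path from the positive to the negative
  axis is longer than its starting position.
\<close>
lemma rtrancl_path_displacement:
  assumes "rtrancl_path r e es e'" "\<And>e e'. r e e' \<Longrightarrow> cofacial e e'"
  shows "fst (fst e) - fst (fst e') \<le> int (length es)"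
  using assms
proof (induction rule: rtrancl_path.induct)
  case (step e e' es e'')
  then have "cofacial e e'" by blast
  then have "fst (fst e) - fst (fst e') \<le> 1" by (auto simp: cofacial_def)
  with step show ?case by simp
qed simp

lemma rtrancl_path_rtranclp: "rtrancl_path r x xs y \<Longrightarrow> z \<in> set xs \<Longrightarrow> r\<^sup>*\<^sup>* x z"
  by (induction rule: rtrancl_path.induct) (auto intro: converse_rtranclp_into_rtranclp)

lemma finite_edge_set_bounded:
  assumes "finite (E :: edge set)"
  obtains K where "\<And>x y b. ((x, y), b) \<in> E \<Longrightarrow> \<bar>x\<bar> \<le> K \<and> \<bar>y\<bar> \<le> K"
proof
  define K where "K = Max (insert 0 ((\<lambda>e. max \<bar>fst (fst e)\<bar> \<bar>snd (fst e)\<bar>) ` E))"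
  fix x y b assume e: "((x, y), b) \<in> E"
  have "max \<bar>x\<bar> \<bar>y\<bar> \<le> K"
    unfolding K_def by (intro Max_ge) (use assms e in \<open>auto intro!: rev_image_eqI\<close>)
  then show "\<bar>x\<bar> \<le> K \<and> \<bar>y\<bar> \<le> K" by simp
qed

lemma finite_row:
  fixes E :: "edge set"
  assumes "finite E" shows "finite {a. p a \<and> ((a, y), True) \<in> E}"
proof (rule finite_subset)
  show "{a. p a \<and> ((a, y), True) \<in> E} \<subseteq> (\<lambda>e. fst (fst e)) ` E" by force
qed (use assms in simp)

lemma odd_row_from:
  fixes E :: "edge set"
  assumes "finite E"
  shows "odd (card {a. x \<le> a \<and> ((a, y), True) \<in> E}) \<longleftrightarrow>
    (((x, y), True) \<in> E) \<noteq> odd (card {a. x + 1 \<le> a \<and> ((a, y), True) \<in> E})"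
proof -
  let ?A = "{a. x + 1 \<le> a \<and> ((a, y), True) \<in> E}"
  have "{a. x \<le> a \<and> ((a, y), True) \<in> E} = (if ((x, y), True) \<in> E then insert x ?A else ?A)"
    by (auto simp: order_le_less)
  then show ?thesis using finite_row[OF assms] by simp
qed

text \<open>
  Let \<open>g x y\<close> be the parity of the number of edges of \<open>E\<close> on the horizontal ray to the right of
  \<open>(x, y)\<close>. Since each face meets \<open>E\<close> evenly, descending induction on \<open>x\<close> shows that \<open>g\<close> changes
  across a vertical edge exactly if that edge is in \<open>E\<close>: the cocycle \<open>E\<close> is the coboundary of \<open>g\<close>. Far to the
  left, where there are no edges of \<open>E\<close>, all rows hence have the same parity, which is even as
  rows far above are empty.
\<close>
lemma even_card_row:
  fixes E :: "edge set"
  assumes fin: "finite E"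
    and faces: "\<And>x y. ((((x, y), True) \<in> E) \<noteq> (((x, y + 1), True) \<in> E)) =
                       ((((x, y), False) \<in> E) \<noteq> (((x + 1, y), False) \<in> E))"
  shows "even (card {a. ((a, y), True) \<in> E})"
proof -
  obtain K where K: "\<And>x y b. ((x, y), b) \<in> E \<Longrightarrow> \<bar>x\<bar> \<le> K \<and> \<bar>y\<bar> \<le> K"
    using finite_edge_set_bounded[OF fin] by blast
  define g where "g x y = odd (card {a. x \<le> a \<and> ((a, y), True) \<in> E})" for x y
  have vert: "(g x y \<noteq> g x (y + 1)) = (((x, y), False) \<in> E)" if "x \<le> K + 1" for x y
    using that
  proof (induction x rule: int_le_induct)
    case base
    have "{a. K + 1 \<le> a \<and> ((a, y), True) \<in> E} = {}" for y using K by fastforce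
    then have "card {a. K + 1 \<le> a \<and> ((a, y), True) \<in> E} = 0" for y by (metis card.empty)
    moreover have "((K + 1, y), False) \<notin> E" using K by fastforce
    ultimately show ?case by (simp add: g_def)
  next
    case (step x)
    have "g (x - 1) y = ((((x - 1, y), True) \<in> E) \<noteq> g x y)" for y
      unfolding g_def using odd_row_from[OF fin, of "x - 1" y] by simp
    with step faces[of "x - 1" y] show ?case by auto
  qed
  have whole: "even (card {a. ((a, y), True) \<in> E}) = (\<not> g (- K - 1) y)" for y
  proof -
    have "{a. - K - 1 \<le> a \<and> ((a, y), True) \<in> E} = {a. ((a, y), True) \<in> E}" using K by fastforce
    then show ?thesis by (simp add: g_def)
  qed
  have far: "\<not> g x y" if "K + 1 \<le> y" for x y
  proof -
    have "{a. x \<le> a \<and> ((a, y), True) \<in> E} = {}" using K that by fastforce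
    then show ?thesis unfolding g_def by (metis card.empty even_zero)
  qed
  have "\<not> g (- K - 1) y" if "y \<le> K + 1" for y
    using that
  proof (induction y rule: int_le_induct)
    case (step y)
    have "((- K - 1, y - 1), False) \<notin> E" using K by fastforce
    moreover have "- K - 1 \<le> K + 1 \<or> g (- K - 1) (y - 1) = g (- K - 1) y"
    proof (rule disjCI)
      assume "g (- K - 1) (y - 1) \<noteq> g (- K - 1) y"
      then have "E \<noteq> {}" by (auto simp: g_def)
      then obtain x y b where "((x, y), b) \<in> E" by (metis all_not_in_conv surj_pair)
      then show "- K - 1 \<le> K + 1" using K by fastforce
    qed
    ultimately show ?case using vert[of "- K - 1" "y - 1"] step by auto
  qed (use far in auto)
  then have "\<not> g (- K - 1) y" using far[of y "- K - 1"] by (cases "y \<le> K + 1") auto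
  then show ?thesis by (simp add: whole)
qed

lemma finite_edge_boundary:
  assumes "finite F" shows "finite (edge_boundary F)"
proof (rule finite_subset)
  show "edge_boundary F \<subseteq> (F \<union> (\<lambda>(x, y). (x - 1, y)) ` F \<union> (\<lambda>(x, y). (x, y - 1)) ` F) \<times> UNIV"
  proof
    fix e assume "e \<in> edge_boundary F"
    then show "e \<in> (F \<union> (\<lambda>(x, y). (x - 1, y)) ` F \<union> (\<lambda>(x, y). (x, y - 1)) ` F) \<times> UNIV"
      by (cases e rule: far_end.cases) (force simp: edge_boundary_def)+
  qed
qed (use assms in auto)

text \<open>
  Walking along a ray from a site to infinity, membership in the finite set \<open>F\<close> changes once per
  boundary edge and finally fails.
\<close>
lemma odd_boundary_crossings:
  assumes "finite F"
  shows "odd (card {a. x \<le> a \<and> ((a, y), True) \<in> edge_boundary F}) = ((x, y) \<in> F)"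
proof -
  have fin: "finite (edge_boundary F)" by (rule finite_edge_boundary[OF assms])
  obtain K where K: "\<And>x y b. ((x, y), b) \<in> F \<times> (UNIV :: bool set) \<Longrightarrow> \<bar>x\<bar> \<le> K \<and> \<bar>y\<bar> \<le> K"
    by (rule finite_edge_set_bounded[of "F \<times> (UNIV :: bool set)"]) (use assms in auto)
  have far: "(x, y) \<notin> F" if "K + 1 \<le> x" for x using K[of x y True] that by auto
  have far': "card {a. x \<le> a \<and> ((a, y), True) \<in> edge_boundary F} = 0" if "K + 1 \<le> x" for x
  proof -
    have "{a. x \<le> a \<and> ((a, y), True) \<in> edge_boundary F} = {}"
      using far that by (auto simp: edge_boundary_def)
    then show ?thesis by (metis card.empty)
  qed
  show ?thesis
  proof (cases "x \<le> K + 1")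
    case True
    then show ?thesis
    proof (induction x rule: int_le_induct)
      case base show ?case using far far' by simp
    next
      case (step x)
      then show ?case using odd_row_from[OF fin, of "x - 1" y] by (auto simp: edge_boundary_def)
    qed
  qed (use far far' in auto)
qed

text \<open>
  \<open>E1\<close> is the part of the edge boundary connected to the positive axis through common faces. A face
  meets the whole boundary evenly and contains either all or none of its boundary edges in \<open>E1\<close>, so
  \<open>E1\<close> crosses the horizontal axis an even number of times. It contains all boundary edges on the
  positive axis, an odd number of them, and therefore one on the negative axis as well. A simple
  path between the two axes is cut off after \<open>j\<close> steps, where \<open>j\<close> is the position of its first edge.
\<close>
theorem surrounding_edge_path:
  assumes F: "finite F" and origin: "(0, 0) \<in> F"
  obtains j es where "es \<in> edge_paths ((int j, 0), True) j" "distinct es" "set es \<subseteq> edge_boundary F"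
proof -
  define E where "E = edge_boundary F"
  define r where "r e e' \<longleftrightarrow> e \<in> E \<and> e' \<in> E \<and> cofacial e e'" for e e'
  define ray :: "int \<Rightarrow> edge" where "ray a = ((a, 0), True)" for a
  define E1 where "E1 = {e. \<exists>a\<ge>0. ray a \<in> E \<and> r\<^sup>*\<^sup>* (ray a) e}"
  have finE: "finite E" unfolding E_def by (rule finite_edge_boundary[OF F])
  have E1E: "E1 \<subseteq> E"
  proof
    fix e assume "e \<in> E1"
    then obtain a where "ray a \<in> E" "r\<^sup>*\<^sup>* (ray a) e" by (auto simp: E1_def)
    from this(2,1) show "e \<in> E" by (induction rule: rtranclp_induct) (auto simp: r_def)
  qed
  have closed: "e' \<in> E1" if "e \<in> E1" "e' \<in> E" "cofacial e e'" for e e'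
  proof -
    have "r e e'" using that E1E by (auto simp: r_def)
    then show ?thesis using that(1) by (auto simp: E1_def intro: rtranclp.rtrancl_into_rtrancl)
  qed
  have faces: "((((x, y), True) \<in> E1) \<noteq> (((x, y + 1), True) \<in> E1)) =
               ((((x, y), False) \<in> E1) \<noteq> (((x + 1, y), False) \<in> E1))" for x y
  proof -
    have E: "((((x, y), True) \<in> E) \<noteq> (((x, y + 1), True) \<in> E)) =
             ((((x, y), False) \<in> E) \<noteq> (((x + 1, y), False) \<in> E))"
      by (auto simp: E_def edge_boundary_def add.commute)
    show ?thesis
    proof (cases "face_edges (x, y) \<inter> E1 = {}")
      case False
      then obtain e where "e \<in> face_edges (x, y)" "e \<in> E1" by blast
      then have "e' \<in> E1 \<longleftrightarrow> e' \<in> E" if "e' \<in> face_edges (x, y)" for e'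
        using that closed[of e e'] E1E by (auto simp: cofacial_def simp del: face_edges.simps)
      with E show ?thesis by auto
    qed auto
  qed
  have "\<exists>a<0. ray a \<in> E1"
  proof (rule ccontr)
    assume no: "\<not> (\<exists>a<0. ray a \<in> E1)"
    have "{a. ((a, 0), True) \<in> E1} = {a. 0 \<le> a \<and> ((a, 0), True) \<in> E}"
    proof (intro set_eqI iffI; clarsimp)
      fix a assume "((a, 0), True) \<in> E1"
      then show "0 \<le> a \<and> ((a, 0), True) \<in> E" using no E1E by (force simp: ray_def)
    next
      fix a :: int assume "0 \<le> a" "((a, 0), True) \<in> E"
      then show "((a, 0), True) \<in> E1" by (auto simp: E1_def ray_def intro!: exI[of _ a])
    qed
    moreover have "even (card {a. ((a, 0), True) \<in> E1})"
      using finE E1E faces by (intro even_card_row) (auto intro: finite_subset)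
    ultimately show False using odd_boundary_crossings[OF F, of 0 0] origin by (simp add: E_def)
  qed
  then obtain a b where ab: "a < 0" "0 \<le> b" "ray b \<in> E" "r\<^sup>*\<^sup>* (ray b) (ray a)" by (auto simp: E1_def)
  from ab(4) obtain ys where "rtrancl_path r (ray b) ys (ray a)" by (auto simp: rtranclp_eq_rtrancl_path)
  then obtain xs where xs: "rtrancl_path r (ray b) xs (ray a)" "distinct (ray b # xs)"
    by (metis rtrancl_path_distinct)
  have cof: "cofacial e e'" if "r e e'" for e e' using that by (simp add: r_def)
  have "b - a \<le> int (length xs)"
    using rtrancl_path_displacement[OF xs(1) cof] by (simp add: ray_def)
  then have len: "nat b \<le> length xs" using ab by linarith
  have inE: "e \<in> E" if "e \<in> set xs" for e
    using rtrancl_path_rtranclp[OF xs(1) that] ab E1E by (auto simp: E1_def)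
  show ?thesis
  proof
    show "ray b # take (nat b) xs \<in> edge_paths ((int (nat b), 0), True) (nat b)"
      using rtrancl_path_edge_paths[OF xs(1) cof len] ab by (simp add: ray_def)
    show "distinct (ray b # take (nat b) xs)"
      using xs(2) by (auto dest: in_set_takeD)
    show "set (ray b # take (nat b) xs) \<subseteq> edge_boundary F"
      using inE ab by (auto simp: E_def dest: in_set_takeD)
  qed
qed

section \<open>Percolation on the square grid\<close>

definition cell :: "plane \<Rightarrow> site \<Rightarrow> region" where
  "cell v s = {p. v $ 1 + of_int (fst s) \<le> p $ 1 \<and> p $ 1 \<le> v $ 1 + of_int (fst s) + 1 \<and>
                  v $ 2 + of_int (snd s) \<le> p $ 2 \<and> p $ 2 \<le> v $ 2 + of_int (snd s) + 1}"

definition open_cell :: "plane \<Rightarrow> site \<Rightarrow> region" where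
  "open_cell v s = {p. v $ 1 + of_int (fst s) < p $ 1 \<and> p $ 1 < v $ 1 + of_int (fst s) + 1 \<and>
                  v $ 2 + of_int (snd s) < p $ 2 \<and> p $ 2 < v $ 2 + of_int (snd s) + 1}"

lemma translate_square_grid: "translate v square_grid = range (cell v)"
proof -
  have "(+) v ` cbox (\<chi> i. real_of_int (k $ i)) (\<chi> i. real_of_int (k $ i) + 1) = cell v (k $ 1, k $ 2)"
    for k :: "int ^ 2"
  proof -
    have "(+) v ` cbox (\<chi> i. real_of_int (k $ i)) (\<chi> i. real_of_int (k $ i) + 1) =
        cbox (v + (\<chi> i. real_of_int (k $ i))) (v + (\<chi> i. real_of_int (k $ i) + 1))"
      by (rule cbox_translation[symmetric])
    also have "\<dots> = cell v (k $ 1, k $ 2)"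
      by (auto simp: cell_def mem_box_cart forall_2)
    finally show ?thesis .
  qed
  then have "translate v square_grid = range (\<lambda>k :: int ^ 2. cell v (k $ 1, k $ 2))"
    by (simp add: translate_def square_grid_def image_image)
  also have "\<dots> = range (cell v)"
  proof safe
    fix x y show "cell v (x, y) \<in> range (\<lambda>k :: int ^ 2. cell v (k $ 1, k $ 2))"
      by (rule image_eqI[of _ _ "vector [x, y]"]) (auto simp: vector_2)
  qed auto
  finally show ?thesis .
qed

lemma cell_eq_cbox: "cell v s = cbox (vector [v $ 1 + of_int (fst s), v $ 2 + of_int (snd s)])
    (vector [v $ 1 + of_int (fst s) + 1, v $ 2 + of_int (snd s) + 1])"
  by (auto simp: cell_def mem_box_cart forall_2 vector_2)

lemma open_cell_eq_box: "open_cell v s = box (vector [v $ 1 + of_int (fst s), v $ 2 + of_int (snd s)])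
    (vector [v $ 1 + of_int (fst s) + 1, v $ 2 + of_int (snd s) + 1])"
  by (auto simp: open_cell_def mem_box_cart forall_2 vector_2)

lemma emeasure_open_cell: "emeasure lborel (open_cell v s) = 1"
proof -
  define a b :: plane where "a = vector [v $ 1 + of_int (fst s), v $ 2 + of_int (snd s)]"
    and "b = vector [v $ 1 + of_int (fst s) + 1, v $ 2 + of_int (snd s) + 1]"
  have "a $ k \<le> b $ k" for k using exhaust_2[of k] by (auto simp: a_def b_def vector_2)
  then have le: "a \<bullet> i \<le> b \<bullet> i" if "i \<in> Basis" for i
    using that by (auto simp: Basis_vec_def inner_axis)
  have ne: "cbox a b \<noteq> {}" using le by (auto simp: box_ne_empty)
  have "emeasure lborel (open_cell v s) = emeasure lborel (box a b)"
    by (simp add: open_cell_eq_box a_def b_def)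
  also have "\<dots> = emeasure lborel (cbox a b)" using le by simp
  also have "\<dots> = ennreal (measure lborel (cbox a b))"
    by (rule emeasure_eq_ennreal_measure) (use emeasure_lborel_cbox_finite[of a b] in auto)
  also have "measure lborel (cbox a b) = (\<Prod>i\<in>UNIV. b $ i - a $ i)" by (rule content_cbox_cart[OF ne])
  also have "\<dots> = 1" by (simp add: UNIV_2 a_def b_def vector_2)
  finally show ?thesis by simp
qed

lemma open_cell_disjoint: "p \<in> open_cell v s \<Longrightarrow> p \<in> open_cell v s' \<Longrightarrow> s = s'"
proof -
  have "\<lfloor>p $ 1 - v $ 1\<rfloor> = fst s \<and> \<lfloor>p $ 2 - v $ 2\<rfloor> = snd s" if "p \<in> open_cell v s" for s
    using that by (auto simp: open_cell_def intro!: floor_unique)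
  then show "p \<in> open_cell v s \<Longrightarrow> p \<in> open_cell v s' \<Longrightarrow> s = s'" by (metis prod_eqI)
qed

text \<open>
  The open cells are disjoint and have area one.
\<close>
lemma infinite_cells_area:
  assumes "infinite S" shows "area (\<Union>(cell v ` S)) = \<infinity>"
proof -
  have "of_nat n \<le> area (\<Union>(cell v ` S))" for n
  proof -
    obtain T where T: "finite T" "card T = n" "T \<subseteq> S" using infinite_arbitrarily_large[OF assms] by blast
    have meas: "open_cell v s \<in> sets lborel" for s by (simp add: open_cell_eq_box)
    have "of_nat n = (\<Sum>s\<in>T. emeasure lborel (open_cell v s))" using T by (simp add: emeasure_open_cell)
    also have "\<dots> = emeasure lborel (\<Union>s\<in>T. open_cell v s)"
      using T meas open_cell_disjoint
      by (intro sum_emeasure) (auto simp: disjoint_family_on_def)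
    also have "\<dots> \<le> emeasure lborel (\<Union>(cell v ` S))"
    proof (rule emeasure_mono)
      show "(\<Union>s\<in>T. open_cell v s) \<subseteq> \<Union>(cell v ` S)"
        using T by (force simp: open_cell_def cell_def)
      have "countable S" by (rule countable_subset[of _ UNIV]) auto
      then show "\<Union>(cell v ` S) \<in> sets lborel"
        by (intro sets.countable_Union) (auto simp: cell_eq_cbox)
    qed
    finally show ?thesis by (simp add: area_def)
  qed
  then have "\<not> area (\<Union>(cell v ` S)) < top" using ennreal_Ex_less_of_nat by (meson not_less)
  then show ?thesis using less_top by (metis infinity_ennreal_def)
qed

text \<open>
  The middle half of an edge of the grid, in the plane. The whole edges share endpoints, whereas the
  middle halves keep a distance of at least \<open>1 / 4\<close> from each other, so that their lengths add up.
  This costs a factor 2 in length, which only changes the rate of decay.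
\<close>
fun edge_middle :: "plane \<Rightarrow> edge \<Rightarrow> plane set" where
  "edge_middle v ((x, y), True) =
     {p. p $ 1 = v $ 1 + of_int x + 1 \<and> v $ 2 + of_int y + 1 / 4 \<le> p $ 2 \<and> p $ 2 \<le> v $ 2 + of_int y + 3 / 4}"
| "edge_middle v ((x, y), False) =
     {p. p $ 2 = v $ 2 + of_int y + 1 \<and> v $ 1 + of_int x + 1 / 4 \<le> p $ 1 \<and> p $ 1 \<le> v $ 1 + of_int x + 3 / 4}"

lemma edge_middle_subset: "edge_middle v e \<subseteq> cell v (fst e) \<inter> cell v (far_end e)"
  by (cases e rule: far_end.cases) (auto simp: cell_def)

lemma edge_middle_projection:
  "\<exists>i a. \<forall>s. a \<le> s \<and> s \<le> a + 1 / 2 \<longrightarrow> (\<exists>p\<in>edge_middle v e. p $ i = s)"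
proof (cases e rule: far_end.cases)
  case (1 x y)
  have "\<exists>p\<in>edge_middle v e. p $ 2 = s" if "v $ 2 + of_int y + 1 / 4 \<le> s" "s \<le> v $ 2 + of_int y + 1 / 4 + 1 / 2" for s
    by (rule bexI[of _ "vector [v $ 1 + of_int x + 1, s]"]) (use 1 that in \<open>auto simp: vector_2\<close>)
  then show ?thesis by blast
next
  case (2 x y)
  have "\<exists>p\<in>edge_middle v e. p $ 1 = s" if "v $ 1 + of_int x + 1 / 4 \<le> s" "s \<le> v $ 1 + of_int x + 1 / 4 + 1 / 2" for s
    by (rule bexI[of _ "vector [s, v $ 2 + of_int y + 1]"]) (use 2 that in \<open>auto simp: vector_2\<close>)
  then show ?thesis by blast
qed

lemma edge_middle_separated:
  assumes "e \<noteq> e'" "p \<in> edge_middle v e" "q \<in> edge_middle v e'"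
  shows "1 / 4 \<le> dist p q"
proof -
  have int: "real_of_int x + 1 \<le> real_of_int y \<or> real_of_int y \<le> real_of_int x" for x y
    by (cases "x < y") auto
  have int': "real_of_int x + 1 \<le> real_of_int y \<or> x = y \<or> real_of_int y + 1 \<le> real_of_int x" for x y
    using int[of x y] int[of y x] by auto
  have "1 / 4 \<le> \<bar>(p - q) $ 1\<bar> \<or> 1 / 4 \<le> \<bar>(p - q) $ 2\<bar>"
  proof (cases e rule: far_end.cases; cases e' rule: far_end.cases)
    fix x y x' y' assume e: "e = ((x, y), True)" "e' = ((x', y'), True)"
    with assms(2,3) have "p $ 1 = v $ 1 + of_int x + 1" "v $ 2 + of_int y + 1 / 4 \<le> p $ 2" "p $ 2 \<le> v $ 2 + of_int y + 3 / 4"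
      "q $ 1 = v $ 1 + of_int x' + 1" "v $ 2 + of_int y' + 1 / 4 \<le> q $ 2" "q $ 2 \<le> v $ 2 + of_int y' + 3 / 4" by auto
    moreover have "x \<noteq> x' \<or> y \<noteq> y'" using e assms(1) by auto
    ultimately show ?thesis using int'[of x x'] int'[of y y'] unfolding vector_minus_component by linarith
  next
    fix x y x' y' assume e: "e = ((x, y), False)" "e' = ((x', y'), False)"
    with assms(2,3) have "p $ 2 = v $ 2 + of_int y + 1" "v $ 1 + of_int x + 1 / 4 \<le> p $ 1" "p $ 1 \<le> v $ 1 + of_int x + 3 / 4"
      "q $ 2 = v $ 2 + of_int y' + 1" "v $ 1 + of_int x' + 1 / 4 \<le> q $ 1" "q $ 1 \<le> v $ 1 + of_int x' + 3 / 4" by auto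
    moreover have "x \<noteq> x' \<or> y \<noteq> y'" using e assms(1) by auto
    ultimately show ?thesis using int'[of x x'] int'[of y y'] unfolding vector_minus_component by linarith
  next
    fix x y x' y' assume e: "e = ((x, y), True)" "e' = ((x', y'), False)"
    with assms(2,3) have "p $ 1 = v $ 1 + of_int x + 1"
      "v $ 1 + of_int x' + 1 / 4 \<le> q $ 1" "q $ 1 \<le> v $ 1 + of_int x' + 3 / 4" by auto
    then show ?thesis using int[of x x'] unfolding vector_minus_component by linarith
  next
    fix x y x' y' assume e: "e = ((x, y), False)" "e' = ((x', y'), True)"
    with assms(2,3) have "q $ 1 = v $ 1 + of_int x' + 1"
      "v $ 1 + of_int x + 1 / 4 \<le> p $ 1" "p $ 1 \<le> v $ 1 + of_int x + 3 / 4" by auto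
    then show ?thesis using int[of x' x] unfolding vector_minus_component by linarith
  qed
  then show ?thesis
    using component_le_norm_cart[of "p - q" 1] component_le_norm_cart[of "p - q" 2] by (auto simp: dist_norm)
qed

definition edges_between :: "plane \<Rightarrow> edge set \<Rightarrow> region \<Rightarrow> region \<Rightarrow> edge set" where
  "edges_between v E A B = {e\<in>E. (cell v (fst e) \<subseteq> A \<and> cell v (far_end e) \<subseteq> B) \<or>
                                 (cell v (fst e) \<subseteq> B \<and> cell v (far_end e) \<subseteq> A)}"

lemma common_points_frontier:
  assumes Q: "tessellation Q" "A \<in> Q" "B \<in> Q" "A \<noteq> B" shows "A \<inter> B \<subseteq> frontier A \<inter> frontier B"
proof -
  have "p \<in> frontier A" if "p \<in> A" "p \<in> B" "A \<in> Q" "B \<in> Q" "A \<noteq> B" for A B p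
    using tessellation_eqI[OF Q(1) that(3,4)] that closure_subset by (auto simp: frontier_def)
  with Q show ?thesis by blast
qed

text \<open>
  Different regions of a tessellation meet only in their frontiers, so every grid edge between them
  lies on their common boundary.
\<close>
lemma edges_between_length:
  assumes Q: "tessellation Q" "A \<in> Q" "B \<in> Q" "A \<noteq> B" and E: "finite E"
  shows "ennreal (real (card (edges_between v E A B)) * (1 / 2)) \<le> common_length A B"
  unfolding common_length_def
proof (rule sum_projections_le_curve_length[where T = "edge_middle v" and \<delta> = "1 / 4"])
  show "finite (edges_between v E A B)" using E by (simp add: edges_between_def)
  fix e assume "e \<in> edges_between v E A B"
  then have "edge_middle v e \<subseteq> A \<inter> B" using edge_middle_subset[of v e] by (auto simp: edges_between_def)
  then show "edge_middle v e \<subseteq> frontier A \<inter> frontier B" using common_points_frontier[OF Q] by blast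
  show "\<exists>i a. \<forall>s. a \<le> s \<and> s \<le> a + 1 / 2 \<longrightarrow> (\<exists>p\<in>edge_middle v e. p $ i = s)"
    by (rule edge_middle_projection)
next
  fix e e' p q assume "e \<noteq> e'" "p \<in> edge_middle v e" "q \<in> edge_middle v e'"
  then show "1 / 4 \<le> dist p q" by (rule edge_middle_separated)
qed auto

definition edge_closed :: "plane \<Rightarrow> config \<Rightarrow> edge \<Rightarrow> bool" where
  "edge_closed v Q e \<longleftrightarrow> \<not> in_same_region Q (cell v (fst e)) (cell v (far_end e))"

lemma edge_closed_before_merge:
  assumes "edge_closed v (merge Q A B) e" shows "edge_closed v Q e"
proof -
  have "\<exists>R'\<in>merge Q A B. R \<subseteq> R'" if "R \<in> Q" for R
    using that by (cases "R \<in> {A, B}") (auto simp: merge_def)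
  with assms show ?thesis unfolding edge_closed_def in_same_region_def by (meson order_trans)
qed

text \<open>
  As long as all edges of \<open>E\<close> are closed, each of them lies between two regions that may merge, and
  the merger opens it. A merger that opens \<open>k\<close> edges of \<open>E\<close> has rate at least \<open>c * k / 2\<close>, so the total
  rate at which the indicator \<open>f\<close> drops to 0 is at least \<open>c * card E / 2\<close>.
\<close>
lemma closed_edges_drift:
  assumes P: "tessellation P" "P = range (cell v)" "W \<subseteq> P" "finite W"
    and c: "0 < c" and bnd: "\<And>A B. polygonal A \<Longrightarrow> polygonal B \<Longrightarrow> non_overlapping A B \<Longrightarrow>
              ennreal c * common_length A B \<le> ennreal (rate A B)"
    and E: "finite E" "\<And>e. e \<in> E \<Longrightarrow> cell v (fst e) \<in> W \<and> cell v (far_end e) \<in> W"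
    and Q: "Q \<in> window_states P W"
  defines "f \<equiv> \<lambda>Q. if \<forall>e\<in>E. edge_closed v Q e then 1 else (0::real)"
  shows "(\<Sum>Q'\<in>successors W Q. jump_rate rate W Q Q' * (f Q' - f Q)) \<le> - (c / 2 * card E) * f Q"
proof (cases "\<forall>e\<in>E. edge_closed v Q e")
  case False
  then obtain e where e: "e \<in> E" "\<not> edge_closed v Q e" by blast
  have "f Q' = 0" if "Q' \<in> successors W Q" for Q'
  proof -
    have "\<not> edge_closed v Q' e"
      using that e(2) edge_closed_before_merge[of v Q _ _ e] unfolding successors_def by blast
    then show ?thesis using e(1) by (auto simp: f_def)
  qed
  moreover have "f Q = 0" using False by (auto simp: f_def)
  ultimately show ?thesis by simp
next
  case True
  then have fQ: "f Q = 1" by (simp add: f_def)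
  have T: "tessellation Q" using Q by (rule window_state_tessellation)
  have poly: "polygonal R" if "R \<in> Q" for R using T that by (simp add: tessellation_def)
  have "cell v s \<in> P" for s using P(2) by simp
  then have cell_poly: "polygonal (cell v s)" for s using P(1) unfolding tessellation_def by blast
  define J where "J Q' = (case merging_pair W Q Q' of (A, B) \<Rightarrow> edges_between v E A B)" for Q'
  have finS: "finite (successors W Q)"
  proof (rule finite_subset)
    show "successors W Q \<subseteq> window_states P W"
      using merge_window_state[OF P(1,3) Q] by (auto simp: successors_def)
  qed (rule finite_window_states[OF P(4)])
  have jump_le: "jump_rate rate W Q Q' * (f Q' - f Q) \<le> - (c / 2 * card (J Q'))" if Q': "Q' \<in> successors W Q" for Q'
  proof -
    obtain A B where AB: "merging_pair W Q Q' = (A, B)" "may_merge W Q A B" "Q' = merge Q A B"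
      using Q' by (rule merging_pairE)
    have m: "A \<in> Q" "B \<in> Q" "A \<noteq> B" "common_length A B > 0"
      using AB(2) by (auto simp: may_merge_def neighbours_def)
    have J: "J Q' = edges_between v E A B" and jr: "jump_rate rate W Q Q' = rate A B"
      by (simp_all add: J_def jump_rate_def AB(1))
    have "non_overlapping A B" using T m by (auto simp: tessellation_def pairwise_def)
    then have r: "ennreal c * common_length A B \<le> ennreal (rate A B)" using m poly bnd by blast
    have "0 < ennreal c * common_length A B" using c m by (simp add: ennreal_zero_less_mult_iff)
    with r have "0 < ennreal (rate A B)" by (rule order_less_le_trans[rotated])
    then have r0: "0 < rate A B" by (simp add: ennreal_less_zero_iff)
    have "ennreal (c * (real (card (J Q')) * (1 / 2))) = ennreal c * ennreal (real (card (J Q')) * (1 / 2))"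
      using c by (intro ennreal_mult) auto
    also have "\<dots> \<le> ennreal c * common_length A B"
      unfolding J by (intro mult_left_mono edges_between_length[OF T m(1-3) E(1)]) simp
    also note r
    finally have r1: "c / 2 * card (J Q') \<le> rate A B" using r0 by (simp add: ennreal_le_iff)
    show ?thesis
    proof (cases "J Q' = {}")
      case True
      moreover have "f Q' \<le> 1" by (simp add: f_def)
      ultimately show ?thesis using r0 by (simp add: jr fQ mult_nonneg_nonpos)
    next
      case False
      then obtain e where e: "e \<in> edges_between v E A B" by (auto simp: J)
      then have "\<not> edge_closed v Q' e" "e \<in> E"
        by (auto simp: edges_between_def edge_closed_def in_same_region_def AB(3) merge_def)
      then have "f Q' = 0" by (auto simp: f_def)
      then show ?thesis using r1 by (simp add: jr fQ)
    qed
  qed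
  have cover: "E \<subseteq> (\<Union>Q'\<in>successors W Q. J Q')"
  proof
    fix e assume e: "e \<in> E"
    let ?s = "cell v (fst e)" and ?s' = "cell v (far_end e)"
    have W: "?s \<in> W" "?s' \<in> W" using E(2)[OF e] by auto
    obtain A where A: "A \<in> Q" "?s \<subseteq> A" using Q by (rule window_state_region) (use P in auto)
    obtain B where B: "B \<in> Q" "?s' \<subseteq> B" using Q by (rule window_state_region) (use P in auto)
    have neq: "A \<noteq> B" using True e A B by (auto simp: edge_closed_def in_same_region_def)
    have "edges_between v {e} A B = {e}" using A B by (auto simp: edges_between_def)
    then have "ennreal (1 / 2) \<le> common_length A B"
      using edges_between_length[OF T A(1) B(1) neq, of "{e}" v] by simp
    then have "0 < common_length A B" by (rule order_less_le_trans[rotated]) (subst ennreal_less_zero_iff, simp)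
    moreover have "A \<subseteq> \<Union>W" "B \<subseteq> \<Union>W"
      using window_state_region_in_window[OF P(1) Q P(3)] W A B by blast+
    ultimately have mm: "may_merge W Q A B" using A B neq by (simp add: may_merge_def neighbours_def)
    define Q' where "Q' = merge Q A B"
    have Q': "Q' \<in> successors W Q" using mm by (auto simp: successors_def Q'_def)
    obtain A1 B1 where AB: "merging_pair W Q Q' = (A1, B1)" "may_merge W Q A1 B1" "Q' = merge Q A1 B1"
      using Q' by (rule merging_pairE)
    have m: "A1 \<in> Q" "B1 \<in> Q" using AB(2) by (auto simp: may_merge_def neighbours_def)
    \<comment> \<open>The representative pair of the target is \<open>A\<close>, \<open>B\<close> again, in some order: the merged region
      \<open>A \<union> B\<close> is new, hence equal to \<open>A1 \<union> B1\<close>.\<close>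
    have "A \<union> B \<in> merge Q A B" by (simp add: merge_def)
    also have "merge Q A B = merge Q A1 B1" using AB(3) by (simp only: Q'_def)
    finally have "A \<union> B \<in> insert (A1 \<union> B1) (Q - {A1, B1})" by (simp only: merge_def)
    moreover have "A \<union> B \<notin> Q"
    proof
      assume U: "A \<union> B \<in> Q"
      have "A \<union> B = A" by (rule tessellation_subset_eqI[OF T U A(1) cell_poly[of "fst e"]]) (use A in auto)
      moreover have "A \<union> B = B" by (rule tessellation_subset_eqI[OF T U B(1) cell_poly[of "far_end e"]]) (use B in auto)
      ultimately show False using neq by simp
    qed
    ultimately have U: "A \<union> B = A1 \<union> B1" by blast
    have "A \<in> {A1, B1}" "B \<in> {A1, B1}"
      by (rule tessellation_subset_Union[OF T]; use A B m U in auto)+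
    then have "e \<in> J Q'" using neq A B e by (auto simp: J_def AB(1) edges_between_def)
    then show "e \<in> (\<Union>Q'\<in>successors W Q. J Q')" using Q' by blast
  qed
  have finJ: "finite (J Q')" for Q' using E(1) by (auto simp: J_def edges_between_def split: prod.splits)
  have "card E \<le> (\<Sum>Q'\<in>successors W Q. card (J Q'))"
    using card_mono[OF _ cover] card_UN_le[OF finS, of J] finS finJ by (meson finite_UN le_trans)
  then have "real (card E) \<le> (\<Sum>Q'\<in>successors W Q. real (card (J Q')))"
    by (metis of_nat_le_iff of_nat_sum)
  then have "c / 2 * card E \<le> (\<Sum>Q'\<in>successors W Q. c / 2 * card (J Q'))"
    by (subst sum_distrib_left[symmetric]) (rule mult_left_mono, use c in auto)
  moreover have "(\<Sum>Q'\<in>successors W Q. jump_rate rate W Q Q' * (f Q' - f Q)) \<le>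
      (\<Sum>Q'\<in>successors W Q. - (c / 2 * card (J Q')))" by (rule sum_mono[OF jump_le])
  ultimately show ?thesis by (simp add: fQ sum_negf)
qed

text \<open>
  The substitute for independence: the bound is the one for edges that open independently at rate
  \<open>c / 2\<close>. The windows are taken large enough to contain all cells next to \<open>E\<close>.
\<close>
lemma closed_edges_cover:
  fixes M :: "'w measure"
  assumes X: "empire_process rate P M X" and P: "tessellation P" "P = range (cell v)"
    and c: "0 < c" and bnd: "\<And>A B. polygonal A \<Longrightarrow> polygonal B \<Longrightarrow> non_overlapping A B \<Longrightarrow>
              ennreal c * common_length A B \<le> ennreal (rate A B)"
    and E: "finite E" and t: "0 \<le> t"
  shows "\<exists>V\<in>sets M. measure M V \<le> exp (- c * t / 2) ^ card E \<and>
           (AE \<omega> in M. (\<forall>e\<in>E. edge_closed v (X t \<omega>) e) \<longrightarrow> \<omega> \<in> V)"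
proof -
  interpret prob_space M using X by (simp add: empire_process_def)
  obtain r Z where r: "filterlim r at_top sequentially"
    and Z: "\<And>n :: nat. window_chain M rate P {A\<in>P. A \<subseteq> cball 0 (r n)} (Z n)"
    and lim: "\<And>t. 0 \<le> t \<Longrightarrow> AE \<omega> in M. \<forall>A\<in>P. \<forall>B\<in>P. \<forall>\<^sub>F n in sequentially.
           in_same_region (Z n t \<omega>) A B = in_same_region (X t \<omega>) A B"
    by (rule empire_process_windows[OF X P(1)]) (rule that)
  define W where "W n = {A\<in>P. A \<subseteq> cball 0 (r n)}" for n
  define f where "f Q = (if \<forall>e\<in>E. edge_closed v Q e then 1 else (0::real))" for Q
  have "bounded (\<Union>e\<in>E. cell v (fst e) \<union> cell v (far_end e))"
    using E by (auto simp: cell_eq_cbox)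
  then obtain \<rho> where "(\<Union>e\<in>E. cell v (fst e) \<union> cell v (far_end e)) \<subseteq> ball 0 \<rho>"
    using bounded_subset_ballD by blast
  then have \<rho>: "(\<Union>e\<in>E. cell v (fst e) \<union> cell v (far_end e)) \<subseteq> cball 0 \<rho>"
    using ball_subset_cball by (rule subset_trans)
  have "\<forall>\<^sub>F n in sequentially. \<rho> \<le> r n" using r by (auto simp: filterlim_at_top)
  then obtain N where N: "\<And>n. n \<ge> N \<Longrightarrow> \<rho> \<le> r n" by (auto simp: eventually_sequentially)
  have EW: "cell v (fst e) \<in> W n \<and> cell v (far_end e) \<in> W n" if "e \<in> E" "n \<ge> N" for e n
    using \<rho> that N[OF that(2)] P(2) by (fastforce simp: W_def)
  define U where "U n = {\<omega>\<in>space M. Z n t \<omega> \<in> {Q\<in>window_states P (W n). 1 \<le> f Q}}" for n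
  have "U n \<in> events \<and> prob (U n) \<le> exp (- c * t / 2) ^ card E" if n: "n \<ge> N" for n
  proof
    interpret window_chain M rate P "W n" "Z n" using Z by (simp add: W_def)
    show "U n \<in> events"
      unfolding U_def using t finite_states by (intro states_event) auto
    have "prob (U n) \<le> exp (- (c / 2 * card E) * t) * f P / 1"
      unfolding U_def
    proof (rule markov_bound)
      fix Q assume Q: "Q \<in> states"
      show "(\<Sum>Q'\<in>successors (W n) Q. jump_rate rate (W n) Q Q' * (f Q' - f Q)) \<le> - (c / 2 * card E) * f Q"
        unfolding f_def
        by (rule closed_edges_drift[OF P WP finW c bnd E _ Q]) (use EW n in auto)
    qed (use t in \<open>auto simp: f_def\<close>)
    also have "\<dots> \<le> exp (- (c / 2 * card E) * t)" by (simp add: f_def)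
    also have "\<dots> = exp (- c * t / 2) ^ card E" by (simp add: mult_ac flip: exp_of_nat_mult)
    finally show "prob (U n) \<le> exp (- c * t / 2) ^ card E" .
  qed
  then obtain V where V: "V \<in> events" "prob V \<le> exp (- c * t / 2) ^ card E"
      "\<And>\<omega>. \<forall>\<^sub>F n in sequentially. \<omega> \<in> U n \<Longrightarrow> \<omega> \<in> V"
    using eventually_event_cover[of N U] by blast
  have st: "AE \<omega> in M. Z n t \<omega> \<in> window_states P (W n)" for n
  proof -
    interpret window_chain M rate P "W n" "Z n" using Z by (simp add: W_def)
    show ?thesis using t by (rule AE_states)
  qed
  then have "AE \<omega> in M. \<forall>n. Z n t \<omega> \<in> window_states P (W n)" by (simp add: AE_all_countable)
  with lim[OF t] AE_space have "AE \<omega> in M. (\<forall>e\<in>E. edge_closed v (X t \<omega>) e) \<longrightarrow> \<omega> \<in> V"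
  proof eventually_elim
    case (elim \<omega>)
    show ?case
    proof
      assume cl: "\<forall>e\<in>E. edge_closed v (X t \<omega>) e"
      have "\<forall>\<^sub>F n in sequentially. edge_closed v (Z n t \<omega>) e" if e: "e \<in> E" for e
      proof -
        have "\<forall>\<^sub>F n in sequentially. in_same_region (Z n t \<omega>) (cell v (fst e)) (cell v (far_end e)) =
            in_same_region (X t \<omega>) (cell v (fst e)) (cell v (far_end e))"
          using elim(1) P(2) by blast
        then show ?thesis by eventually_elim (use cl e in \<open>auto simp: edge_closed_def\<close>)
      qed
      then have "\<forall>\<^sub>F n in sequentially. \<forall>e\<in>E. edge_closed v (Z n t \<omega>) e"
        using E by (simp add: eventually_ball_finite_distrib)
      then have "\<forall>\<^sub>F n in sequentially. \<omega> \<in> U n"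
        by eventually_elim (use elim in \<open>auto simp: U_def f_def\<close>)
      then show "\<omega> \<in> V" by (rule V(3))
    qed
  qed
  with V(1,2) show ?thesis by blast
qed

text \<open>
  The region of the cell at the origin consists of finitely many cells, and all edges in the
  boundary of this set of cells are closed.
\<close>
lemma finite_cluster_closed_path:
  assumes X: "empire_process rate P M X" and P: "tessellation P" "P = range (cell v)"
    and \<omega>: "\<omega> \<in> space M" "0 \<le> t" and no: "\<not> infinite_region_appears X \<omega>"
  obtains j es where "es \<in> edge_paths ((int j, 0), True) j" "distinct es" "\<forall>e\<in>set es. edge_closed v (X t \<omega>) e"
proof -
  have "\<exists>C. partition_on P C \<and> X t \<omega> = Union ` C"
    using X \<omega> unfolding empire_process_def by blast
  then obtain C where C: "partition_on P C" "X t \<omega> = Union ` C" by blast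
  have "cell v (0, 0) \<in> \<Union>C" using C(1) P(2) by (auto simp: partition_on_def)
  then obtain b where b: "b \<in> C" "cell v (0, 0) \<in> b" by blast
  have bP: "b \<subseteq> P" using C(1) b(1) by (auto simp: partition_on_def)
  define F where "F = {s. cell v s \<in> b}"
  have bF: "b = cell v ` F" using bP P(2) by (auto simp: F_def)
  have "finite F"
  proof (rule ccontr)
    assume "infinite F"
    then have "area (\<Union>b) = \<infinity>" unfolding bF by (rule infinite_cells_area)
    moreover have "\<Union>b \<in> X t \<omega>" using b C by auto
    ultimately show False using no \<omega>(2) by (auto simp: infinite_region_appears_def)
  qed
  moreover have "(0, 0) \<in> F" using b by (simp add: F_def)
  ultimately obtain j es where es: "es \<in> edge_paths ((int j, 0), True) j" "distinct es" "set es \<subseteq> edge_boundary F"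
    by (rule surrounding_edge_path)
  have "edge_closed v (X t \<omega>) e" if "e \<in> edge_boundary F" for e
    unfolding edge_closed_def
  proof
    assume "in_same_region (X t \<omega>) (cell v (fst e)) (cell v (far_end e))"
    then obtain b' where b': "b' \<in> C" "cell v (fst e) \<subseteq> \<Union>b'" "cell v (far_end e) \<subseteq> \<Union>b'"
      using C(2) by (auto simp: in_same_region_def)
    have "b' \<subseteq> P" using C(1) b'(1) by (auto simp: partition_on_def)
    then have "cell v s \<in> b'" if "cell v s \<subseteq> \<Union>b'" for s
      by (intro tessellation_subset_Union[OF P(1) _ _ that]) (use P(2) in auto)
    then have "cell v (fst e) \<in> b'" "cell v (far_end e) \<in> b'" using b' by blast+
    moreover have "b' = b \<or> b' \<inter> b = {}" using C(1) b(1) b'(1) by (auto simp: partition_on_def disjoint_def)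
    ultimately show False using that by (auto simp: edge_boundary_def F_def)
  qed
  with es show ?thesis using that by blast
qed

text \<open>
  The Peierls argument: for late \<open>t\<close> the event that some path of \<open>j + 1\<close> distinct edges starting at
  position \<open>j\<close> is closed, for some \<open>j\<close>, has small probability by a union bound.
\<close>
theorem infinite_region_on_square_grid:
  fixes M :: "'w measure"
  assumes X: "empire_process rate P M X" and P: "tessellation P" "P = range (cell v)"
    and c: "0 < c" and bnd: "\<And>A B. polygonal A \<Longrightarrow> polygonal B \<Longrightarrow> non_overlapping A B \<Longrightarrow>
              ennreal c * common_length A B \<le> ennreal (rate A B)"
  shows "AE \<omega> in M. infinite_region_appears X \<omega>"
proof -
  interpret prob_space M using X by (simp add: empire_process_def)
  have "AE \<omega> in M. \<not> \<not> infinite_region_appears X \<omega>"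
  proof (rule AE_not_if_small_cover)
    fix \<epsilon> :: real assume \<epsilon>: "0 < \<epsilon>"
    \<comment> \<open>With \<open>8 * q0 \<le> 1 / 2\<close> the geometric series is at most \<open>2 * q0 \<le> \<epsilon>\<close>. The time \<open>t\<close> solves
      \<open>exp (- c * t / 2) = q0\<close>.\<close>
    define q0 where "q0 = min (1 / 16) (\<epsilon> / 2)"
    have q0: "0 < q0" "q0 \<le> 1 / 16" "q0 \<le> \<epsilon> / 2" using \<epsilon> by (auto simp: q0_def)
    define t where "t = 2 / c * (- ln q0)"
    have "0 \<le> - ln q0" using q0 by simp
    then have t: "0 \<le> t" unfolding t_def using c by (intro mult_nonneg_nonneg) auto
    have q: "exp (- c * t / 2) = q0" using c q0 by (simp add: t_def)
    define D where "D j = {es \<in> edge_paths ((int j, 0), True) j. distinct es}" for j :: nat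
    have finD: "finite (D j)" for j by (simp add: D_def finite_edge_paths)
    have "\<forall>es. \<exists>V. V \<in> events \<and> prob V \<le> q0 ^ card (set es) \<and>
        (AE \<omega> in M. (\<forall>e\<in>set es. edge_closed v (X t \<omega>) e) \<longrightarrow> \<omega> \<in> V)"
    proof
      fix es :: "edge list"
      show "\<exists>V. V \<in> events \<and> prob V \<le> q0 ^ card (set es) \<and>
          (AE \<omega> in M. (\<forall>e\<in>set es. edge_closed v (X t \<omega>) e) \<longrightarrow> \<omega> \<in> V)"
        using closed_edges_cover[OF X P c bnd finite_set[of es] t] unfolding q Bex_def .
    qed
    from choice[OF this] obtain V where V': "\<forall>es. V es \<in> events \<and> prob (V es) \<le> q0 ^ card (set es) \<and>
        (AE \<omega> in M. (\<forall>e\<in>set es. edge_closed v (X t \<omega>) e) \<longrightarrow> \<omega> \<in> V es)" ..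
    note V = V'[THEN spec, THEN conjunct1] V'[THEN spec, THEN conjunct2, THEN conjunct1]
      V'[THEN spec, THEN conjunct2, THEN conjunct2]
    define U where "U j = (\<Union>es\<in>D j. V es)" for j
    have U: "U j \<in> events" for j unfolding U_def using finD V(1) by (intro sets.finite_UN) auto
    have pU: "prob (U j) \<le> q0 * (8 * q0) ^ j" for j
    proof -
      have "prob (U j) \<le> (\<Sum>es\<in>D j. prob (V es))"
        unfolding U_def using finD V(1) by (intro finite_measure_subadditive_finite) auto
      also have "\<dots> \<le> (\<Sum>es\<in>D j. q0 ^ Suc j)"
      proof (rule sum_mono)
        fix es assume "es \<in> D j"
        then have "card (set es) = Suc j" using length_edge_paths[of es] by (auto simp: D_def distinct_card)
        then show "prob (V es) \<le> q0 ^ Suc j" using V(2)[of es] by simp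
      qed
      also have "\<dots> = real (card (D j)) * q0 ^ Suc j" by simp
      also have "\<dots> \<le> 8 ^ j * q0 ^ Suc j"
      proof (rule mult_right_mono)
        have "card (D j) \<le> card (edge_paths ((int j, 0), True) j)"
          by (rule card_mono[OF finite_edge_paths]) (auto simp: D_def)
        also have "\<dots> \<le> 8 ^ j" by (rule card_edge_paths)
        finally show "real (card (D j)) \<le> 8 ^ j" by (metis of_nat_le_iff of_nat_numeral of_nat_power)
      qed (use q0 in simp)
      finally show ?thesis by (simp add: power_mult_distrib mult_ac)
    qed
    have geo: "(\<lambda>j. q0 * (8 * q0) ^ j) sums (q0 * (1 / (1 - 8 * q0)))"
      using q0 by (intro sums_mult geometric_sums) auto
    have sU: "summable (\<lambda>j. prob (U j))"
      by (rule summable_comparison_test'[OF sums_summable[OF geo], of 0]) (use pU in auto)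
    have "prob (\<Union>j. U j) \<le> (\<Sum>j. prob (U j))"
      using U sU by (intro finite_measure_subadditive_countably) auto
    also have "\<dots> \<le> (\<Sum>j. q0 * (8 * q0) ^ j)"
      by (rule suminf_le[OF pU sU sums_summable[OF geo]])
    also have "\<dots> = q0 * (1 / (1 - 8 * q0))" by (rule sums_unique[OF geo, symmetric])
    also have "\<dots> \<le> q0 * 2" using q0 by (intro mult_left_mono) (auto simp: field_simps)
    also have "\<dots> \<le> \<epsilon>" using q0 by simp
    finally have "prob (\<Union>j. U j) \<le> \<epsilon>" .
    moreover have "AE \<omega> in M. \<forall>j. \<forall>es\<in>D j. (\<forall>e\<in>set es. edge_closed v (X t \<omega>) e) \<longrightarrow> \<omega> \<in> V es"
      using V(3) finD by (simp add: AE_all_countable AE_finite_all)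
    with AE_space have "AE \<omega> in M. \<not> infinite_region_appears X \<omega> \<longrightarrow> \<omega> \<in> (\<Union>j. U j)"
    proof eventually_elim
      case (elim \<omega>)
      show ?case
      proof
        assume no: "\<not> infinite_region_appears X \<omega>"
        obtain j es where "es \<in> edge_paths ((int j, 0), True) j" "distinct es" "\<forall>e\<in>set es. edge_closed v (X t \<omega>) e"
          by (rule finite_cluster_closed_path[OF X P elim(1) t no])
        with elim(2) show "\<omega> \<in> (\<Union>j. U j)" by (auto simp: D_def U_def)
      qed
    qed
    ultimately show "\<exists>V\<in>events. prob V \<le> \<epsilon> \<and> (AE \<omega> in M. \<not> infinite_region_appears X \<omega> \<longrightarrow> \<omega> \<in> V)"
      using U by (intro bexI[of _ "\<Union>j. U j"]) auto
  qed
  then show ?thesis by simp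
qed

text \<open>
  The bound on the growth of perimeters applies to every initial tessellation. The lower bound on
  the rates is used for the square grid only, and the presumption on initial configurations
  carries hegemony over to all other laws in \<open>I\<close>.
\<close>
theorem proposition1:
  fixes rate :: "region \<Rightarrow> region \<Rightarrow> real"
    and I :: "config measure set"
  assumes "merger_rate rate"
    and "\<forall>\<mu>\<in>I. initial_law \<mu>"
    and "\<exists>\<mu>\<in>I. square_grid_law \<mu>"
    and "initial_choice_irrelevant TYPE('w) rate I"
  shows "((\<exists>c>0. \<forall>A B. polygonal A \<and> polygonal B \<and> non_overlapping A B \<longrightarrow>
              ennreal c * common_length A B \<le> ennreal (rate A B))
            \<longrightarrow> (\<forall>\<mu>\<in>I. hegemonic TYPE('w) rate \<mu>))
       \<and> ((\<exists>C::real. \<forall>P. tessellation P \<longrightarrow> (\<forall>A\<in>P.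
              (\<Sum>B\<in>neighbours P A. ennreal (rate A B) * peri B) \<le> ennreal C * peri A))
            \<longrightarrow> (\<forall>\<mu>. initial_law \<mu> \<longrightarrow> not_hegemonic TYPE('w) rate \<mu>))"
proof (intro conjI impI allI)
  assume "\<exists>c>0. \<forall>A B. polygonal A \<and> polygonal B \<and> non_overlapping A B \<longrightarrow>
              ennreal c * common_length A B \<le> ennreal (rate A B)"
  then obtain c where c: "0 < c" and bnd: "\<And>A B. polygonal A \<Longrightarrow> polygonal B \<Longrightarrow> non_overlapping A B \<Longrightarrow>
              ennreal c * common_length A B \<le> ennreal (rate A B)" by blast
  obtain \<mu> where \<mu>: "\<mu> \<in> I" "square_grid_law \<mu>" using assms(3) by blast
  then have "AE P in \<mu>. \<exists>v. P = translate v square_grid" "AE P in \<mu>. tessellation P"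
    by (auto simp: square_grid_law_def initial_law_def)
  then have "hegemonic TYPE('w) rate \<mu>"
    unfolding hegemonic_def
  proof eventually_elim
    case (elim P)
    then obtain v where "P = range (cell v)" by (auto simp: translate_square_grid)
    then show ?case using infinite_region_on_square_grid[OF _ elim(2) _ c bnd] by blast
  qed
  with \<mu>(1) assms(4) show "\<forall>\<mu>\<in>I. hegemonic TYPE('w) rate \<mu>"
    unfolding initial_choice_irrelevant_def by blast
next
  fix \<mu> assume "\<exists>C::real. \<forall>P. tessellation P \<longrightarrow> (\<forall>A\<in>P.
              (\<Sum>B\<in>neighbours P A. ennreal (rate A B) * peri B) \<le> ennreal C * peri A)"
  then obtain C :: real where C: "\<And>P A. tessellation P \<Longrightarrow> A \<in> P \<Longrightarrow>
      (\<Sum>B\<in>neighbours P A. ennreal (rate A B) * peri B) \<le> ennreal C * peri A" by blast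
  assume "initial_law \<mu>"
  then have "AE P in \<mu>. tessellation P" by (simp add: initial_law_def)
  then show "not_hegemonic TYPE('w) rate \<mu>"
    unfolding not_hegemonic_def
  proof eventually_elim
    case (elim P)
    show ?case using no_infinite_region[OF assms(1) _ elim C] by blast
  qed
qed

end
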